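(* Let $\alpha,\beta>-1/2$ be real. For each integer $n\geq1$, enumerate the points at which $\lvert P_n^{(\alpha,\beta)}\rvert$ has a relative maximum on $[-1,1]$, with endpoint maxima understood one-sidedly, as $$1=x_{0,n}>x_{1,n}>\cdots>x_{n,n}=-1.$$ Then, for every $n\geq1$ and $1\leq k\leq n$, $$\frac{\bigl|P_{n+1}^{(\alpha,\beta)}(x_{k,n+1})\bigr|}{P_{n+1}^{(\alpha,\beta)}(1)}<\frac{\bigl|P_n^{(\alpha,\beta)}(x_{k,n})\bigr|}{P_n^{(\alpha,\beta)}(1)}.$$
   Context: $P_n^{(\alpha,\beta)}$ denotes the Jacobi polynomial of degree $n$ in the standard normalisation $P_n^{(\alpha,\beta)}(1)=(\alpha+1)_n/n!$, where $(a)_n=a(a+1)\cdots(a+n-1)$ is the rising factorial. It satisfies $(1-x^2)y''+[\beta-\alpha-(\alpha+\beta+2)x]y'+n(n+\alpha+\beta+1)y=0$. For $\alpha,\beta>-1/2$ and $n\ge1$ the set of relative maxima of $\lvert P_n^{(\alpha,\beta)}\rvert$ on $[-1,1]$ has exactly $n+1$ elements: the two endpoints $\pm1$ and the $n-1$ zeros of $P_{n-1}^{(\alpha+1,\beta+1)}$ in $(-1,1)$ (equivalently, of the derivative of $P_n^{(\alpha,\beta)}$). The points $x_{k,n}$ are numbered in decreasing order starting from $x=1$. *)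

theory Defs
  imports Complex_Main "HOL-Computational_Algebra.Polynomial"
begin

text \<open>
  The Jacobi polynomial, by its expansion at \<open>x = 1\<close>:
  \<open>P\<^sub>n(x) = (\<alpha>+1)\<^sub>n / n! \<cdot> \<^sub>2F\<^sub>1(-n, n+\<alpha>+\<beta>+1; \<alpha>+1; (1-x)/2)\<close>, with the quotient
  \<open>(\<alpha>+1)\<^sub>n / (\<alpha>+1)\<^sub>k\<close> written as \<open>(\<alpha>+k+1)\<^sub>n\<^sub>-\<^sub>k\<close>.
\<close>

definition jacobi_coeff :: "real \<Rightarrow> real \<Rightarrow> nat \<Rightarrow> nat \<Rightarrow> real" where
  "jacobi_coeff \<alpha> \<beta> n k =
     pochhammer (real n + \<alpha> + \<beta> + 1) k * pochhammer (\<alpha> + real k + 1) (n - k)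
       / (fact k * fact (n - k))"

definition jacobi_poly :: "real \<Rightarrow> real \<Rightarrow> nat \<Rightarrow> real poly" where
  "jacobi_poly \<alpha> \<beta> n = (\<Sum>k\<le>n. smult (jacobi_coeff \<alpha> \<beta> n k) ([:-1/2, 1/2:] ^ k))"

text \<open>
  The next two facts confirm the normalisation and the differential equation, which together
  determine the polynomial for \<open>\<alpha>, \<beta> > -1/2\<close>.
\<close>

lemma poly_jacobi_poly_1: "poly (jacobi_poly \<alpha> \<beta> n) 1 = pochhammer (\<alpha> + 1) n / fact n"
proof -
  have "poly (jacobi_poly \<alpha> \<beta> n) 1 = (\<Sum>k\<le>n. jacobi_coeff \<alpha> \<beta> n k * 0 ^ k)"
    by (simp add: jacobi_poly_def poly_sum)
  also have "\<dots> = jacobi_coeff \<alpha> \<beta> n 0"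
    by (subst sum.remove[of _ 0]) (auto intro!: sum.neutral)
  finally show ?thesis by (simp add: jacobi_coeff_def)
qed

lemma jacobi_coeff_Suc:
  assumes "k < n"
  shows "(real k + 1) * (real k + 1 + \<alpha>) * jacobi_coeff \<alpha> \<beta> n (Suc k) =
         (real n - real k) * (real n + real k + \<alpha> + \<beta> + 1) * jacobi_coeff \<alpha> \<beta> n k"
proof -
  obtain m where m: "n = k + Suc m" using assms by (metis add_Suc_right less_imp_Suc_add)
  define p where "p = pochhammer (real n + \<alpha> + \<beta> + 1) k"
  define q where "q = pochhammer (\<alpha> + real k + 2) m"
  have 1: "pochhammer (\<alpha> + real k + 1) (Suc m) = (\<alpha> + real k + 1) * q"
    unfolding q_def pochhammer_rec by (simp add: algebra_simps)
  have 2: "pochhammer (real n + \<alpha> + \<beta> + 1) (Suc k) = p * (real n + real k + \<alpha> + \<beta> + 1)"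
    unfolding p_def pochhammer_Suc by (simp add: algebra_simps)
  have 3: "jacobi_coeff \<alpha> \<beta> n (Suc k) =
      p * (real n + real k + \<alpha> + \<beta> + 1) * q / ((real k + 1) * fact k * fact m)"
    unfolding jacobi_coeff_def 2 using m by (simp add: q_def algebra_simps)
  have 4: "jacobi_coeff \<alpha> \<beta> n k =
      p * ((\<alpha> + real k + 1) * q) / (fact k * ((real m + 1) * fact m))"
    unfolding jacobi_coeff_def p_def 1[symmetric] using m by (simp add: algebra_simps)
  have 5: "real n - real k = real m + 1" using m by simp
  show ?thesis unfolding 3 4 5
    by (simp add: divide_simps)
qed

lemma jacobi_poly_ode:
  "[:1, 0, -1:] * pderiv (pderiv (jacobi_poly \<alpha> \<beta> n))
     + [:\<beta> - \<alpha>, - (\<alpha> + \<beta> + 2):] * pderiv (jacobi_poly \<alpha> \<beta> n)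
     + smult (real n * (real n + \<alpha> + \<beta> + 1)) (jacobi_poly \<alpha> \<beta> n) = 0"
proof -
  define c where "c = jacobi_coeff \<alpha> \<beta> n"
  define Q where "Q = (\<Sum>k\<le>n. monom (c k) k)"
  let ?t = "[:-1/2, 1/2:] :: real poly"
  have J: "jacobi_poly \<alpha> \<beta> n = pcompose Q ?t"
    by (rule poly_eq_poly_eq_iff[THEN iffD1], rule ext)
      (simp add: jacobi_poly_def Q_def c_def poly_pcompose poly_sum poly_monom)
  have coeffQ: "coeff Q k = (if k \<le> n then c k else 0)" for k
    by (simp add: Q_def coeff_sum)
  have dt: "pderiv ?t = [:1/2:]" by (simp add: pderiv_pCons)
  have D1: "pderiv (pcompose q ?t) = smult (1/2) (pcompose (pderiv q) ?t)" for q
    unfolding pderiv_pcompose dt by simp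
  have D2: "pderiv (pderiv (pcompose Q ?t)) = smult (1/4) (pcompose (pderiv (pderiv Q)) ?t)"
    unfolding D1 Polynomial.pderiv_smult by simp
  define R where "R = [:0, -1, -1:] * pderiv (pderiv Q) + [:- (\<alpha> + 1), - (\<alpha> + \<beta> + 2):] * pderiv Q
      + smult (real n * (real n + \<alpha> + \<beta> + 1)) Q"
  have "coeff R k = 0" for k
  proof -
    have "coeff R k = - (real k + 1) * real k * coeff Q (Suc k) - real k * (real k - 1) * coeff Q k
       - (\<alpha> + 1) * (real k + 1) * coeff Q (Suc k) - (\<alpha> + \<beta> + 2) * real k * coeff Q k
       + real n * (real n + \<alpha> + \<beta> + 1) * coeff Q k"
    proof (cases k)
      case 0 then show ?thesis by (simp add: R_def coeff_pderiv algebra_simps)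
    next
      case (Suc j)
      then show ?thesis
        by (cases j) (simp_all add: R_def coeff_pderiv algebra_simps)
    qed
    also have "\<dots> = (real n - real k) * (real n + real k + \<alpha> + \<beta> + 1) * coeff Q k
        - (real k + 1) * (real k + 1 + \<alpha>) * coeff Q (Suc k)"
      by (simp add: algebra_simps)
    also have "\<dots> = 0"
      using jacobi_coeff_Suc[of k n \<alpha> \<beta>] by (cases "k < n"; cases "k = n") (auto simp: coeffQ c_def)
    finally show ?thesis .
  qed
  then have R: "R = 0" by (simp add: poly_eq_iff)
  have ode: "- u * (1 + u) * poly (pderiv (pderiv Q)) u
      - (\<alpha> + 1 + (\<alpha> + \<beta> + 2) * u) * poly (pderiv Q) u
      + real n * (real n + \<alpha> + \<beta> + 1) * poly Q u = 0" for u
    using arg_cong[OF R, of "\<lambda>p. poly p u"] by (simp add: R_def algebra_simps)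
  show ?thesis unfolding J unfolding D2 unfolding D1
  proof (rule poly_eq_poly_eq_iff[THEN iffD1], rule ext)
    fix x :: real
    define u where "u = (x - 1) / 2"
    have t: "poly ?t x = u" and x: "x = 1 + 2 * u" by (simp_all add: u_def field_simps)
    show "poly ([:1, 0, -1:] * smult (1/4) (pcompose (pderiv (pderiv Q)) ?t)
        + [:\<beta> - \<alpha>, - (\<alpha> + \<beta> + 2):] * smult (1/2) (pcompose (pderiv Q) ?t)
        + smult (real n * (real n + \<alpha> + \<beta> + 1)) (pcompose Q ?t)) x = poly 0 x"
      unfolding poly_add poly_mult poly_smult poly_pcompose t
      using ode[of u] by (simp add: x field_simps)
  qed
qed

text \<open>
  Relative maxima of \<open>f\<close> on \<open>S\<close>: the neighbourhood filter is relative to \<open>S\<close>, so at a boundary point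
  the maximum is understood one-sidedly.
\<close>

definition rel_max_on :: "real set \<Rightarrow> (real \<Rightarrow> real) \<Rightarrow> real set" where
  "rel_max_on S f = {x \<in> S. \<forall>\<^sub>F y in at x within S. f y \<le> f x}"

definition jacobi_maxima :: "real \<Rightarrow> real \<Rightarrow> nat \<Rightarrow> real set" where
  "jacobi_maxima \<alpha> \<beta> n = rel_max_on {-1..1} (\<lambda>x. \<bar>poly (jacobi_poly \<alpha> \<beta> n) x\<bar>)"

text \<open>
  \<open>jacobi_max_pt \<alpha> \<beta> k n\<close> is \<open>x\<^sub>k\<^sub>,\<^sub>n\<close>, the \<open>k\<close>-th element, counted from 0, of the set of relative maxima
  in decreasing order. It is meaningful only if that set is finite with more than \<open>k\<close> elements.
\<close>

definition jacobi_max_pt :: "real \<Rightarrow> real \<Rightarrow> nat \<Rightarrow> nat \<Rightarrow> real" where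
  "jacobi_max_pt \<alpha> \<beta> k n = rev (sorted_list_of_set (jacobi_maxima \<alpha> \<beta> n)) ! k"

end

theory Submission
  imports Defs "HOL-Analysis.Analysis"
begin

text \<open>
  The theorem is a comparison of damped oscillators. Put \<open>x = cos \<theta>\<close>, \<open>a = \<alpha> + 1/2\<close>, \<open>b = \<beta> + 1/2\<close>. The
  normalised polynomial \<open>y(\<theta>) = P\<^sub>n(cos \<theta>) / P\<^sub>n(1)\<close> satisfies \<open>y'' + 2 g y' + \<kappa>\<^sup>2 y = 0\<close> with the damping
  \<open>g(\<theta>) = (a cot(\<theta>/2) - b tan(\<theta>/2)) / 2\<close>, which decreases since \<open>a, b > 0\<close>, and a frequency \<open>\<kappa>\<close>,
  \<open>\<kappa>\<^sup>2 = n (n + a + b)\<close>, which increases with \<open>n\<close>. In polar coordinates \<open>\<kappa> y = R cos \<phi>\<close>, \<open>- y' = R sin \<phi>\<close> of the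
  phase plane, with \<open>h = g / \<kappa>\<close>,
  \<open>\<phi>' = \<kappa> (1 - h sin 2\<phi>)\<close> and \<open>d ln R\<^sup>2 / d\<phi> = - 4 h (sin \<phi>)\<^sup>2 / (1 - h sin 2\<phi>)\<close>.

  The relative maxima of \<open>|y|\<close> are the points where \<open>\<phi>\<close> is a multiple of \<open>\<pi>\<close>, and there \<open>R = \<kappa> |y|\<close>. So
  the \<open>k\<close>-th maxima for two values of \<open>n\<close> are found at the same phase \<open>k \<pi>\<close>, which suggests \<open>\<phi>\<close>
  rather than \<open>\<theta>\<close> as the independent variable; at phase \<open>0\<close> both values of \<open>R / \<kappa>\<close> are \<open>1\<close>. The phase is increasing
  (\<open>phase_speed_numerator_pos\<close>) and runs from \<open>0\<close> to \<open>n \<pi>\<close>, as counting zeros shows (\<open>card_zeros_eq_index\<close>).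

  As the decrement of \<open>ln R\<^sup>2\<close> is increasing in \<open>h\<close>, it suffices that at each phase the larger frequency has
  the larger \<open>h\<close> (\<open>damping_less\<close>). Now \<open>dh/d\<phi> = - D / (1 - h sin 2\<phi>)\<close>, where \<open>D = - g' / \<kappa>\<^sup>2\<close> is a function of
  \<open>h\<close> and \<open>\<kappa>\<close> that decreases strictly in \<open>\<kappa>\<close> for fixed \<open>h\<close> (\<open>damping_decay_less_if_damping_eq\<close>). Hence the
  difference of the two \<open>h\<close> can cross zero only upwards. It starts positive because it tends to \<open>0\<close> at phase
  \<open>0\<close>, where both \<open>h\<close> have the same principal part (\<open>damping_principal_part\<close>), and increases there as long as
  it is nonpositive.
\<close>

section \<open>First zeros and crossings of real functions\<close>

lemma last_zero:
  fixes f :: "real \<Rightarrow> real"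
  assumes cont: "continuous_on {u..v} f" and "u \<le> v" and fu: "f u \<le> 0" and fv: "f v > 0"
  obtains z where "u \<le> z" "z < v" "f z = 0" "\<And>x. z < x \<Longrightarrow> x \<le> v \<Longrightarrow> f x > 0"
proof -
  define S where "S = {u..v} \<inter> f -` {..0}"
  have "closed S" unfolding S_def
    by (rule continuous_closed_preimage[OF cont]) auto
  then have "compact S"
    by (metis S_def compact_Icc compact_Int_closed inf.absorb_iff2 inf_le1)
  moreover have "u \<in> S" using assms by (auto simp: S_def)
  ultimately obtain z where z: "z \<in> S" "\<And>x. x \<in> S \<Longrightarrow> x \<le> z"
    using compact_attains_sup[of S] by blast
  have pos: "f x > 0" if "z < x" "x \<le> v" for x
    using z(1) z(2)[of x] that by (auto simp: S_def not_le[symmetric])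
  have zv: "z < v" using z(1) fv by (cases "z = v") (auto simp: S_def)
  have "f z = 0"
  proof (rule ccontr)
    assume "f z \<noteq> 0"
    then have "f z < 0" using z(1) by (auto simp: S_def)
    then obtain x where x: "z \<le> x" "x \<le> v" "f x = 0"
      using IVT'[of f z 0 v] fv zv z(1) continuous_on_subset[OF cont, of "{z..v}"]
      by (auto simp: S_def)
    with \<open>f z < 0\<close> pos[of x] show False by (cases "x = z") auto
  qed
  with z(1) zv pos show ?thesis by (intro that[of z]) (auto simp: S_def)
qed

lemma first_zero:
  fixes f :: "real \<Rightarrow> real"
  assumes cont: "continuous_on {u..v} f" and "u \<le> v" and fu: "f u > 0" and fv: "f v \<le> 0"
  obtains z where "u < z" "z \<le> v" "f z = 0" "\<And>x. u \<le> x \<Longrightarrow> x < z \<Longrightarrow> f x > 0"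
proof -
  have c: "continuous_on {-v..-u} (\<lambda>x. f (-x))"
    by (rule continuous_on_compose2[OF cont]) (auto intro: continuous_intros)
  obtain z where z: "-v \<le> z" "z < -u" "f (-z) = 0" "\<And>x. z < x \<Longrightarrow> x \<le> -u \<Longrightarrow> f (-x) > 0"
    using last_zero[OF c] assms by auto
  show ?thesis
    by (rule that[of "-z"]) (use z z(4)[of "- x" for x] in auto)
qed

text \<open>At a first zero after \<open>s\<close> the function would come down from positive values.\<close>

lemma positive_if_upward_crossings:
  fixes f f' :: "real \<Rightarrow> real"
  assumes der: "\<And>t. s \<le> t \<Longrightarrow> t < L \<Longrightarrow> (f has_real_derivative f' t) (at t)"
    and up: "\<And>t. s < t \<Longrightarrow> t < L \<Longrightarrow> f t = 0 \<Longrightarrow> f' t > 0"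
    and "f s > 0" and t: "s \<le> t" "t < L"
  shows "f t > 0"
proof (rule ccontr)
  assume "\<not> f t > 0"
  moreover have "continuous_on {s..t} f"
    by (rule DERIV_continuous_on[OF has_field_derivative_at_within[OF der]]) (use t in auto)
  ultimately obtain z where z: "s < z" "z \<le> t" "f z = 0" "\<And>x. s \<le> x \<Longrightarrow> x < z \<Longrightarrow> f x > 0"
    using first_zero[of s t f] assms by (auto simp: not_less)
  obtain d where d: "d > 0" "\<And>h. 0 < h \<Longrightarrow> h < d \<Longrightarrow> f (z - h) < f z"
    using DERIV_pos_inc_left[OF der[of z] up[of z]] z t by auto
  define h where "h = min (d/2) (z - s)"
  have "0 < h" "h < d" "s \<le> z - h" using d z by (auto simp: h_def min_def)
  then show False using d(2)[of h] z by force
qed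

text \<open>
  If a function increases wherever it is nonpositive, then its nonpositive values get smaller
  towards the left end; a function tending to \<open>0\<close> there therefore has none.
\<close>

lemma positive_if_starts_at_zero:
  fixes f f' :: "real \<Rightarrow> real"
  assumes der: "\<And>t. 0 < t \<Longrightarrow> t < L \<Longrightarrow> (f has_real_derivative f' t) (at t)"
    and up: "\<And>t. 0 < t \<Longrightarrow> t < L \<Longrightarrow> f t \<le> 0 \<Longrightarrow> f' t > 0"
    and lim: "(f \<longlongrightarrow> 0) (at_right 0)"
    and t: "0 < t" "t < L"
  shows "f t > 0"
proof (rule ccontr)
  assume "\<not> f t > 0"
  then have ft: "f t \<le> 0" by simp
  have cont: "continuous_on {u..v} f" if "0 < u" "v < L" for u v
    by (rule DERIV_continuous_on[OF has_field_derivative_at_within[OF der]]) (use that in auto)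
  have neg: "f u < 0" if u: "0 < u" "u < t" for u
  proof (rule ccontr)
    assume "\<not> f u < 0"
    obtain d where d: "d > 0" "\<And>h. 0 < h \<Longrightarrow> h < d \<Longrightarrow> f (t - h) < f t"
      using DERIV_pos_inc_left[OF der[of t] up[of t]] ft t by auto
    define v where "v = t - min (d/2) ((t - u) / 2)"
    have v: "u < v" "v < t" using d u by (auto simp: v_def min_def field_simps)
    have "0 < t - v" "t - v < d" using d u by (auto simp: v_def min_def)
    then have "f v < 0" using d(2)[of "t - v"] ft by simp
    moreover have "continuous_on {u..v} (\<lambda>x. - f x)"
      by (intro continuous_on_minus cont) (use u v t in auto)
    ultimately obtain z where z: "u \<le> z" "z < v" "f z = 0" "\<And>x. z < x \<Longrightarrow> x \<le> v \<Longrightarrow> - f x > 0"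
      using last_zero[of u v "\<lambda>x. - f x"] \<open>\<not> f u < 0\<close> v by auto
    obtain d where d: "d > 0" "\<And>h. 0 < h \<Longrightarrow> h < d \<Longrightarrow> f z < f (z + h)"
      using DERIV_pos_inc_right[OF der[of z] up[of z]] z v u t by auto
    define h where "h = min (d/2) (v - z)"
    have "0 < h" "h < d" "z < z + h" "z + h \<le> v" using d z by (auto simp: h_def min_def)
    then show False using d(2)[of h] z(3) z(4)[of "z + h"] by force
  qed
  have mono: "f u \<le> f (t/2)" if u: "0 < u" "u < t/2" for u
  proof (rule DERIV_nonneg_imp_nondecreasing[where f = f])
    show "\<exists>y. DERIV f x :> y \<and> 0 \<le> y" if "u \<le> x" "x \<le> t/2" for x
      using der[of x] up[of x] neg[of x] that u t by force
  qed (use u in auto)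
  have "\<forall>\<^sub>F u in at_right 0. f u \<le> f (t/2)"
    unfolding eventually_at_right_field using mono t by (intro exI[of _ "t/2"]) auto
  then have "0 \<le> f (t/2)"
    using tendsto_upperbound[OF lim] by auto
  with neg[of "t/2"] t show False by auto
qed

section \<open>Polynomial solutions of the Jacobi equation\<close>

text \<open>
  With \<open>x = cos \<theta>\<close>, \<open>a = \<alpha> + 1/2\<close> and \<open>b = \<beta> + 1/2\<close>, Jacobi's equation is that of a damped oscillator,
  \<open>y'' + 2 g(\<theta>) y' + \<lambda> y = 0\<close> with \<open>g(\<theta>) = (a cot(\<theta>/2) - b tan(\<theta>/2)) / 2\<close>. Since this \<open>g\<close> equals
  \<open>drift a b x / sin \<theta>\<close> and \<open>g' = - damping_slope a b x / (sin \<theta>)\<^sup>2\<close>, working with the two linear functions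
  below keeps everything polynomial in \<open>x\<close>.
\<close>

definition drift :: "real \<Rightarrow> real \<Rightarrow> real \<Rightarrow> real" where
  "drift a b x = ((a - b) + (a + b) * x) / 2"

definition damping_slope :: "real \<Rightarrow> real \<Rightarrow> real \<Rightarrow> real" where
  "damping_slope a b x = (a * (1 + x) + b * (1 - x)) / 2"

definition jacobi_ode :: "real \<Rightarrow> real \<Rightarrow> real \<Rightarrow> real poly \<Rightarrow> bool" where
  "jacobi_ode a b l p \<longleftrightarrow> (\<forall>x. (1 - x^2) * poly (pderiv (pderiv p)) x
      = (2 * drift a b x + x) * poly (pderiv p) x - l * poly p x)"

lemma two_drift: "2 * drift a b x = (a - b) + (a + b) * x"
  by (simp add: drift_def)

lemma jacobi_odeD:
  "jacobi_ode a b l p \<Longrightarrow> (1 - x^2) * poly (pderiv (pderiv p)) x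
      = (2 * drift a b x + x) * poly (pderiv p) x - l * poly p x"
  by (simp add: jacobi_ode_def)

lemma jacobi_ode_pderiv:
  assumes "jacobi_ode a b l p"
  shows "jacobi_ode (a + 1) (b + 1) (l - (a + b + 1)) (pderiv p)"
proof -
  have "poly ([:1, 0, -1:] * pderiv (pderiv p)) x
      = poly ([:a - b, a + b + 1:] * pderiv p - smult l p) x" for x
    using jacobi_odeD[OF assms, of x]
    unfolding two_drift by (simp add: algebra_simps power2_eq_square)
  then have "[:1, 0, -1:] * pderiv (pderiv p) = [:a - b, a + b + 1:] * pderiv p - smult l p"
    by (rule poly_eq_poly_eq_iff[THEN iffD1, OF ext])
  then have eq: "pderiv ([:1, 0, -1:] * pderiv (pderiv p))
      = pderiv ([:a - b, a + b + 1:] * pderiv p - smult l p)" by simp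
  show ?thesis unfolding jacobi_ode_def
  proof
    fix x
    from arg_cong[OF eq[unfolded pderiv_mult pderiv_diff Polynomial.pderiv_smult], of "\<lambda>q. poly q x"]
    show "(1 - x^2) * poly (pderiv (pderiv (pderiv p))) x
      = (2 * drift (a + 1) (b + 1) x + x) * poly (pderiv (pderiv p)) x
        - (l - (a + b + 1)) * poly (pderiv p) x"
      unfolding two_drift
      by (simp add: pderiv_pCons algebra_simps power2_eq_square)
  qed
qed

text \<open>
  A nontrivial solution has simple zeros in \<open>(-1, 1)\<close> and does not vanish at \<open>\<plusminus>1\<close>: at a point that
  violates this, the equation makes the derivative \<open>p'\<close> violate it as well, and \<open>p'\<close> solves a Jacobi
  equation of its own.
\<close>

lemma jacobi_ode_eq_0:
  assumes "jacobi_ode a b l p" "a > 0" "b > 0" "x \<in> {-1..1}"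
    and "poly p x = 0" "(1 - x^2) * poly (pderiv p) x = 0"
  shows "p = 0"
  using assms
proof (induction "degree p" arbitrary: p a b l rule: less_induct)
  case less
  have ode: "(1 - x^2) * poly (pderiv (pderiv p)) x = (2 * drift a b x + x) * poly (pderiv p) x"
    using jacobi_odeD[OF less.prems(1), of x] less.prems by simp
  have 1: "poly (pderiv p) x = 0 \<and> (1 - x^2) * poly (pderiv (pderiv p)) x = 0"
  proof (cases "1 - x^2 = 0")
    case True
    then have "x = 1 \<or> x = -1" using power2_eq_1_iff[of x] by auto
    then have "2 * drift a b x + x \<noteq> 0" using less.prems by (auto simp: drift_def field_simps)
    then show ?thesis using ode True by auto
  next
    case False then show ?thesis using ode less.prems by auto
  qed
  show ?case
  proof (cases "degree p = 0")
    case True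
    then show ?thesis using less.prems(5) by (auto elim!: degree_eq_zeroE)
  next
    case False
    then have "pderiv p = 0"
      using less.hyps[OF _ jacobi_ode_pderiv[OF less.prems(1)]] 1 less.prems
      by (auto simp: degree_pderiv)
    with False show ?thesis by (simp add: pderiv_eq_0_iff)
  qed
qed

text \<open>
  The phase speed is \<open>\<kappa> - g sin 2\<phi>\<close> with \<open>sin 2\<phi>\<close> expressed by \<open>p\<close> and \<open>p'\<close>. The factor \<open>sin \<theta>\<close> of \<open>y'\<close> cancels the
  pole of \<open>g\<close>.
\<close>

definition energy :: "real \<Rightarrow> real poly \<Rightarrow> real \<Rightarrow> real" where
  "energy \<kappa> p x = \<kappa>^2 * poly p x ^ 2 + (1 - x^2) * poly (pderiv p) x ^ 2"

definition phase_speed :: "real \<Rightarrow> real \<Rightarrow> real \<Rightarrow> real poly \<Rightarrow> real \<Rightarrow> real" where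
  "phase_speed a b \<kappa> p x
     = \<kappa> * (1 - 2 * drift a b x * poly p x * poly (pderiv p) x / energy \<kappa> p x)"

locale jacobi_solution =
  fixes a b \<kappa> :: real and p :: "real poly"
  assumes a: "a > 0" and b: "b > 0" and \<kappa>: "\<kappa> > 0" and p: "p \<noteq> 0"
    and ode: "jacobi_ode a b (\<kappa>^2) p"
begin

abbreviation "p' \<equiv> pderiv p"

lemma energy_pos: assumes "x \<in> {-1..1}" shows "energy \<kappa> p x > 0"
proof -
  have s: "1 - x^2 \<ge> 0" using assms abs_square_le_1[of x] by auto
  have "energy \<kappa> p x \<noteq> 0"
  proof
    assume "energy \<kappa> p x = 0"
    then have "\<kappa>^2 * poly p x ^ 2 = 0" "(1 - x^2) * poly p' x ^ 2 = 0"
      using s unfolding energy_def by (simp_all add: add_nonneg_eq_0_iff)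
    then show False using jacobi_ode_eq_0[OF ode a b assms] p \<kappa> by auto
  qed
  then show ?thesis using s unfolding energy_def
    by (metis add_nonneg_nonneg less_eq_real_def mult_nonneg_nonneg zero_le_power2)
qed

lemma deriv_at_1: "(2 * a + 1) * poly p' 1 = \<kappa>^2 * poly p 1"
  using jacobi_odeD[OF ode, of 1] by (simp add: drift_def)

lemma deriv_at_m1: "(2 * b + 1) * poly p' (-1) = - (\<kappa>^2) * poly p (-1)"
  using jacobi_odeD[OF ode, of "-1"] by (simp add: drift_def algebra_simps)

text \<open>
  The numerator \<open>N\<close> of the phase speed satisfies
  \<open>(1 - x\<^sup>2) N' = 2 drift N - 2 damping_slope p p'\<close>, and where it vanishes \<open>p p'\<close> has the sign of the drift.
  So \<open>N\<close> could only decrease through a zero on the right of the zero of the drift, which its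
  positive value at \<open>1\<close> forbids, and dually on the left.
\<close>

lemma phase_speed_numerator_pos:
  assumes x: "x \<in> {-1..1}"
  shows "energy \<kappa> p x - 2 * drift a b x * poly p x * poly p' x > 0"
proof (rule ccontr)
  define N where "N x = energy \<kappa> p x - 2 * drift a b x * poly p x * poly p' x" for x
  define N' where "N' x = 2 * \<kappa>^2 * poly p x * poly p' x - 2 * x * poly p' x ^ 2
     + 2 * (1 - x^2) * poly p' x * poly (pderiv p') x - (a + b) * poly p x * poly p' x
     - 2 * drift a b x * poly p' x ^ 2 - 2 * drift a b x * poly p x * poly (pderiv p') x" for x
  assume "\<not> ?thesis"
  then have Nx: "N x \<le> 0" by (simp add: N_def)
  have der: "(N has_real_derivative N' x) (at x)" for x
    unfolding N_def N'_def energy_def drift_def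
    by (auto intro!: derivative_eq_intros simp: field_simps power2_eq_square)
  have cont: "continuous_on S N" for S
    by (rule DERIV_continuous_on[OF has_field_derivative_at_within[OF der]])
  have crit: "(1 - z^2) * N' z = - 2 * damping_slope a b z * poly p z * poly p' z"
      and sgn: "energy \<kappa> p z = 2 * drift a b z * poly p z * poly p' z" if "N z = 0" for z
  proof -
    define s P P1 P2 q where "s = 1 - z^2" and "P = poly p z" and "P1 = poly p' z"
      and "P2 = poly (pderiv p') z" and "q = drift a b z"
    have o: "s * P2 = (2 * q + z) * P1 - \<kappa>^2 * P"
      using jacobi_odeD[OF ode, of z] by (simp add: s_def P_def P1_def P2_def q_def)
    have z: "\<kappa>^2 * P^2 + s * P1^2 = 2 * q * P * P1"
      using that by (simp add: N_def energy_def s_def P_def P1_def q_def)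
    have "(1 - z^2) * N' z = s * (2 * \<kappa>^2 * P * P1 - 2 * z * P1^2 - (a + b) * P * P1 - 2 * q * P1^2)
        + 2 * s * P1 * (s * P2) - 2 * q * P * (s * P2)"
      unfolding N'_def by (simp add: s_def P_def P1_def P2_def q_def algebra_simps)
    also have "\<dots> = 2 * q * (\<kappa>^2 * P^2 + s * P1^2 - 2 * q * P * P1)
        - P * P1 * ((a + b) * s + 2 * q * z)"
      unfolding o by (simp add: algebra_simps power2_eq_square)
    also have "\<dots> = - P * P1 * ((a + b) * s + 2 * q * z)" using z by simp
    also have "(a + b) * s + 2 * q * z = 2 * damping_slope a b z"
      by (simp add: s_def q_def drift_def damping_slope_def field_simps power2_eq_square)
    finally show "(1 - z^2) * N' z = - 2 * damping_slope a b z * poly p z * poly p' z"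
      by (simp add: P_def P1_def algebra_simps)
    show "energy \<kappa> p z = 2 * drift a b z * poly p z * poly p' z" using that by (simp add: N_def)
  qed
  have slope: "damping_slope a b z > 0" if "-1 < z" "z < 1" for z
    unfolding damping_slope_def using a b that by (simp add: add_pos_pos)
  have p1: "poly p 1 \<noteq> 0" "poly p (-1) \<noteq> 0"
    using jacobi_ode_eq_0[OF ode a b, of 1] jacobi_ode_eq_0[OF ode a b, of "-1"] p by auto
  have "(2 * a + 1) * N 1 = (2 * a + 1) * (\<kappa>^2 * poly p 1 ^ 2) - 2 * a * poly p 1 * ((2 * a + 1) * poly p' 1)"
    by (simp add: N_def energy_def drift_def algebra_simps)
  also have "\<dots> = \<kappa>^2 * poly p 1 ^ 2"
    unfolding deriv_at_1 by (simp add: algebra_simps power2_eq_square)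
  finally have "(2 * a + 1) * N 1 > 0" using p1 \<kappa> by simp
  then have N1: "N 1 > 0" using a by (simp add: zero_less_mult_iff)
  have "(2 * b + 1) * N (-1) = (2 * b + 1) * (\<kappa>^2 * poly p (-1) ^ 2)
      + 2 * b * poly p (-1) * ((2 * b + 1) * poly p' (-1))"
    by (simp add: N_def energy_def drift_def algebra_simps)
  also have "\<dots> = \<kappa>^2 * poly p (-1) ^ 2"
    unfolding deriv_at_m1 by (simp add: algebra_simps power2_eq_square)
  finally have "(2 * b + 1) * N (-1) > 0" using p1 \<kappa> by simp
  then have Nm1: "N (-1) > 0" using b by (simp add: zero_less_mult_iff)
  have s: "1 - z^2 > 0" if "-1 < z" "z < 1" for z :: real
    using that abs_square_less_1[of z] by auto
  consider "drift a b x = 0" | "drift a b x > 0" | "drift a b x < 0" by linarith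
  then show False
  proof cases
    case 1
    then show False using Nx energy_pos[OF x] by (simp add: N_def)
  next
    case 2
    obtain z where z: "x \<le> z" "z < 1" "N z = 0" "\<And>y. z < y \<Longrightarrow> y \<le> 1 \<Longrightarrow> N y > 0"
      using last_zero[OF cont _ Nx N1] x by auto
    have "drift a b z \<ge> drift a b x"
      unfolding drift_def using z a b by (simp add: mult_left_mono)
    with 2 have q: "drift a b z > 0" by simp
    have z1: "-1 < z" using z x Nm1 by (cases "z = -1") auto
    have "poly p z * poly p' z > 0"
      using sgn[OF z(3)] energy_pos[of z] z1 z q by (simp add: zero_less_mult_iff mult.assoc)
    then have "(1 - z^2) * N' z < 0"
      using crit[OF z(3)] slope[of z] z z1 by (simp add: mult.assoc)
    then have "N' z < 0" using s[of z] z z1 by (simp add: mult_less_0_iff)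
    then obtain d where d: "d > 0" "\<And>h. 0 < h \<Longrightarrow> h < d \<Longrightarrow> N (z + h) < N z"
      using DERIV_neg_dec_right[OF der] by blast
    define h where "h = min (d/2) (1 - z)"
    have "0 < h" "h < d" "z + h \<le> 1" using d z by (auto simp: h_def min_def)
    then show False using d(2)[of h] z(3) z(4)[of "z + h"] by force
  next
    case 3
    obtain z where z: "-1 < z" "z \<le> x" "N z = 0" "\<And>y. -1 \<le> y \<Longrightarrow> y < z \<Longrightarrow> N y > 0"
      using first_zero[OF cont _ Nm1 Nx] x by auto
    have "drift a b z \<le> drift a b x"
      unfolding drift_def using z a b by (simp add: mult_left_mono)
    with 3 have q: "drift a b z < 0" by simp
    have z1: "z < 1" using z x N1 by (cases "z = 1") auto
    have "poly p z * poly p' z < 0"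
      using sgn[OF z(3)] energy_pos[of z] z1 z q
      by (simp add: zero_less_mult_iff mult_less_0_iff mult.assoc)
    then have "(1 - z^2) * N' z > 0"
      using crit[OF z(3)] slope[of z] z z1 by (simp add: mult.assoc mult_pos_neg)
    then have "N' z > 0" using s[of z] z z1 by (simp add: zero_less_mult_iff)
    then obtain d where d: "d > 0" "\<And>h. 0 < h \<Longrightarrow> h < d \<Longrightarrow> N (z - h) < N z"
      using DERIV_pos_inc_left[OF der] by blast
    define h where "h = min (d/2) (z + 1)"
    have "0 < h" "h < d" "-1 \<le> z - h" using d z by (auto simp: h_def min_def)
    then show False using d(2)[of h] z(3) z(4)[of "z - h"] by force
  qed
qed

lemma phase_speed_eq:
  assumes "x \<in> {-1..1}"
  shows "phase_speed a b \<kappa> p x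
    = \<kappa> * (energy \<kappa> p x - 2 * drift a b x * poly p x * poly p' x) / energy \<kappa> p x"
  using energy_pos[OF assms] by (simp add: phase_speed_def field_simps)

lemma phase_speed_pos: "x \<in> {-1..1} \<Longrightarrow> phase_speed a b \<kappa> p x > 0"
  using energy_pos phase_speed_numerator_pos \<kappa> by (simp add: phase_speed_eq)

end

section \<open>The phase of a polynomial solution\<close>

text \<open>
  In the phase plane, \<open>(\<kappa> p(cos \<theta>), - d/d\<theta> p(cos \<theta>)) = R (cos \<phi>, sin \<phi>)\<close> with \<open>R\<^sup>2\<close> the energy, and \<open>\<phi>\<close> is
  normalised by \<open>\<phi>(0) = 0\<close>, up to a common sign of the two components. Taking \<open>\<phi>\<close> as an antiderivative
  of its explicit speed, which is smooth up to the singular points \<open>0\<close> and \<open>\<pi>\<close>, avoids choosing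
  branches of an arctangent.
\<close>

locale jacobi_phase = jacobi_solution +
  fixes \<phi> :: "real \<Rightarrow> real"
  assumes phase_0: "\<phi> 0 = 0"
    and phase_deriv:
      "\<And>\<theta>. \<theta> \<in> {0..pi} \<Longrightarrow> (\<phi> has_real_derivative phase_speed a b \<kappa> p (cos \<theta>)) (at \<theta>)"

lemma (in jacobi_solution) phase_exists: "\<exists>\<phi>. jacobi_phase a b \<kappa> p \<phi>"
proof -
  define f where "f \<theta> = phase_speed a b \<kappa> p (cos \<theta>)" for \<theta>
  have "energy \<kappa> p (cos \<theta>) \<noteq> 0" for \<theta>
    using energy_pos[of "cos \<theta>"] by simp
  then have cont: "continuous_on {-1..4} f"
    unfolding f_def phase_speed_def
    by (intro continuous_intros) (auto simp: energy_def drift_def intro!: continuous_intros)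
  \<comment> \<open>An interval containing \<open>0\<close> and \<open>pi\<close> in its interior makes the derivatives there two-sided.\<close>
  define F where "F x = integral {-1..x} f" for x
  have "((\<lambda>x. F x - F 0) has_real_derivative f t) (at t)" if "t \<in> {0..pi}" for t
  proof -
    have t: "t \<in> {-1<..<4}" using that pi_less_4 by auto
    have "(F has_real_derivative f t) (at t within {-1..4})"
      unfolding F_def by (rule integral_has_real_derivative[OF cont]) (use t in auto)
    then have "(F has_real_derivative f t) (at t)"
      using t by (simp add: at_within_Icc_at)
    then show ?thesis by (auto intro!: derivative_eq_intros)
  qed
  then have "jacobi_phase a b \<kappa> p (\<lambda>x. F x - F 0)"
    by unfold_locales (simp_all add: f_def)
  then show ?thesis by blast
qed

context jacobi_phase
begin

lemma phase_cont: "continuous_on {0..pi} \<phi>"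
  by (rule DERIV_continuous_on[OF has_field_derivative_at_within[OF phase_deriv]])

lemma phase_mono: "0 \<le> u \<Longrightarrow> u < v \<Longrightarrow> v \<le> pi \<Longrightarrow> \<phi> u < \<phi> v"
  by (rule DERIV_pos_imp_increasing[where f = \<phi>])
    (auto intro!: exI conjI phase_deriv phase_speed_pos)

lemma energy_cos: "energy \<kappa> p (cos \<theta>) = (\<kappa> * poly p (cos \<theta>))^2 + (sin \<theta> * poly p' (cos \<theta>))^2"
  by (simp add: energy_def power_mult_distrib cos_squared_eq)

lemma energy_deriv:
  "((\<lambda>\<theta>. energy \<kappa> p (cos \<theta>)) has_real_derivative
      - 4 * drift a b (cos \<theta>) * sin \<theta> * poly p' (cos \<theta>) ^ 2) (at \<theta>)"
proof -
  define x where "x = cos \<theta>"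
  have o: "(1 - x^2) * poly (pderiv p') x = (2 * drift a b x + x) * poly p' x - \<kappa>^2 * poly p x"
    by (rule jacobi_odeD[OF ode])
  have "((\<lambda>\<theta>. energy \<kappa> p (cos \<theta>)) has_real_derivative
      (2 * \<kappa>^2 * poly p x * poly p' x - 2 * x * poly p' x ^ 2
        + 2 * poly p' x * ((1 - x^2) * poly (pderiv p') x)) * (- sin \<theta>)) (at \<theta>)"
    unfolding energy_def x_def
    by (auto intro!: derivative_eq_intros DERIV_chain2[OF poly_DERIV]
        simp: algebra_simps power2_eq_square)
  then show ?thesis
    unfolding o by (rule DERIV_cong) (simp add: algebra_simps power2_eq_square x_def)
qed

text \<open>
  The component \<open>W\<close> of the phase plane vector orthogonal to the direction \<open>\<phi>\<close> satisfies a linear equation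
  that makes \<open>W\<^sup>2\<close> a constant multiple of the energy; it vanishes at \<open>0\<close>.
\<close>

lemma phase_polar:
  assumes \<theta>: "\<theta> \<in> {0..pi}"
  shows "\<kappa> * poly p (cos \<theta>) * sin (\<phi> \<theta>) = sin \<theta> * poly p' (cos \<theta>) * cos (\<phi> \<theta>)"
proof -
  define W where "W \<theta> = \<kappa> * poly p (cos \<theta>) * sin (\<phi> \<theta>) - sin \<theta> * poly p' (cos \<theta>) * cos (\<phi> \<theta>)" for \<theta>
  have E0: "energy \<kappa> p (cos t) \<noteq> 0" for t
    using energy_pos[of "cos t"] by simp
  have dW: "(W has_real_derivative
      - 2 * drift a b (cos t) * sin t * poly p' (cos t) ^ 2 / energy \<kappa> p (cos t) * W t) (at t)"
    if t: "t \<in> {0..pi}" for t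
  proof -
    define x A B E where "x = cos t" and "A = \<kappa> * poly p x" and "B = sin t * poly p' x"
      and "E = energy \<kappa> p x"
    have E: "E = A^2 + B^2" "E \<noteq> 0" using E0[of t] by (auto simp: E_def A_def B_def x_def energy_cos)
    have o: "(sin t)^2 * poly (pderiv p') x = (2 * drift a b x + x) * poly p' x - \<kappa> * A"
      using jacobi_odeD[OF ode, of x] by (simp add: x_def A_def sin_squared_eq power2_eq_square[of \<kappa>])
    define v where "v = phase_speed a b \<kappa> p x"
    have der: "(W has_real_derivative (- \<kappa> * B) * sin (\<phi> t) + A * cos (\<phi> t) * v
       - (x * poly p' x - (sin t)^2 * poly (pderiv p') x) * cos (\<phi> t) + B * sin (\<phi> t) * v) (at t)"
      unfolding W_def A_def B_def x_def v_def
      by (auto intro!: derivative_eq_intros phase_deriv[OF t] DERIV_chain2[OF poly_DERIV]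
          simp: algebra_simps power2_eq_square)
    define k where "k = 2 * drift a b x * poly p' x / E"
    have v: "v = \<kappa> - k * A"
      by (simp add: v_def phase_speed_def A_def E_def k_def field_simps)
    have k: "2 * drift a b x * poly p' x = k * E" using E(2) by (simp add: k_def)
    have "(- \<kappa> * B) * sin (\<phi> t) + A * cos (\<phi> t) * v
       - (x * poly p' x - (sin t)^2 * poly (pderiv p') x) * cos (\<phi> t) + B * sin (\<phi> t) * v
      = (2 * drift a b x * poly p' x) * cos (\<phi> t) - k * (A^2 * cos (\<phi> t) + A * B * sin (\<phi> t))"
      unfolding o v by (simp add: algebra_simps power2_eq_square)
    also have "\<dots> = - (k * B) * (A * sin (\<phi> t) - B * cos (\<phi> t))"
      unfolding k E(1) by (simp add: algebra_simps power2_eq_square)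
    also have "k * B = 2 * drift a b x * sin t * poly p' x ^ 2 / E"
      by (simp add: k_def B_def power2_eq_square)
    finally show ?thesis
      by (intro DERIV_cong[OF der]) (simp add: W_def A_def B_def x_def E_def)
  qed
  have der0: "((\<lambda>t. W t ^ 2 / energy \<kappa> p (cos t)) has_real_derivative 0) (at t)" if t: "t \<in> {0..pi}" for t
  proof -
    define q E where "q = drift a b (cos t) * sin t * poly p' (cos t) ^ 2" and "E = energy \<kappa> p (cos t)"
    have "((\<lambda>t. W t ^ 2) has_real_derivative 2 * W t * (- 2 * q / E * W t)) (at t)"
      using DERIV_power[OF dW[OF t], of 2] by (simp add: q_def E_def mult_ac)
    moreover have "((\<lambda>t. energy \<kappa> p (cos t)) has_real_derivative - 4 * q) (at t)"
      using energy_deriv[of t] by (simp add: q_def mult_ac)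
    ultimately have "((\<lambda>t. W t ^ 2 / energy \<kappa> p (cos t)) has_real_derivative
        (2 * W t * (- 2 * q / E * W t) * E - W t ^ 2 * (- 4 * q)) / (E * E)) (at t)"
      using E0[of t] unfolding E_def by (rule DERIV_divide)
    moreover have "2 * W t * (- 2 * q / E * W t) * E - W t ^ 2 * (- 4 * q) = 0"
      using E0[of t] by (simp add: E_def power2_eq_square)
    ultimately show ?thesis by simp
  qed
  have "continuous_on {0..pi} (\<lambda>t. W t ^ 2 / energy \<kappa> p (cos t))"
    by (rule DERIV_continuous_on[OF has_field_derivative_at_within[OF der0]])
  then have const: "W \<theta> ^ 2 / energy \<kappa> p (cos \<theta>) = W 0 ^ 2 / energy \<kappa> p (cos 0)"
    using \<theta> der0 DERIV_isconst2[of 0 pi "\<lambda>t. W t ^ 2 / energy \<kappa> p (cos t)" \<theta>] by auto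
  then have "W \<theta> ^ 2 / energy \<kappa> p (cos \<theta>) = 0" unfolding const by (simp add: W_def phase_0)
  then show ?thesis using E0[of \<theta>] by (simp add: W_def)
qed

lemma
  assumes \<theta>: "\<theta> \<in> {0..pi}"
  shows energy_sin2: "energy \<kappa> p (cos \<theta>) * (sin (\<phi> \<theta>))^2 = (sin \<theta> * poly p' (cos \<theta>))^2"
    and energy_cos2: "energy \<kappa> p (cos \<theta>) * (cos (\<phi> \<theta>))^2 = (\<kappa> * poly p (cos \<theta>))^2"
    and energy_sin_cos: "energy \<kappa> p (cos \<theta>) * (sin (\<phi> \<theta>) * cos (\<phi> \<theta>))
      = \<kappa> * poly p (cos \<theta>) * (sin \<theta> * poly p' (cos \<theta>))"
proof -
  define A B s c where "A = \<kappa> * poly p (cos \<theta>)" and "B = sin \<theta> * poly p' (cos \<theta>)"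
    and "s = sin (\<phi> \<theta>)" and "c = cos (\<phi> \<theta>)"
  have AB: "A * s = B * c" using phase_polar[OF \<theta>] by (simp add: A_def B_def s_def c_def)
  have sc: "s^2 + c^2 = 1" by (simp add: s_def c_def)
  have E: "energy \<kappa> p (cos \<theta>) = A^2 + B^2" by (simp add: A_def B_def energy_cos)
  have "(A^2 + B^2) * s^2 = (A * s)^2 + B^2 * s^2" by (simp add: algebra_simps power_mult_distrib)
  also have "\<dots> = B^2 * (s^2 + c^2)" unfolding AB by (simp add: algebra_simps power_mult_distrib)
  finally show "energy \<kappa> p (cos \<theta>) * (sin (\<phi> \<theta>))^2 = (sin \<theta> * poly p' (cos \<theta>))^2"
    by (simp add: E sc flip: s_def B_def)
  have "(A^2 + B^2) * c^2 = (B * c)^2 + A^2 * c^2" by (simp add: algebra_simps power_mult_distrib)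
  also have "\<dots> = A^2 * (s^2 + c^2)"
    unfolding AB[symmetric] by (simp add: algebra_simps power_mult_distrib)
  finally show "energy \<kappa> p (cos \<theta>) * (cos (\<phi> \<theta>))^2 = (\<kappa> * poly p (cos \<theta>))^2"
    by (simp add: E sc flip: c_def A_def)
  have "(A^2 + B^2) * (s * c) = A * c * (A * s) + B * s * (B * c)"
    by (simp add: algebra_simps power2_eq_square)
  also have "\<dots> = A * c * (B * c) + B * s * (A * s)" by (simp only: AB)
  also have "\<dots> = A * B * (s^2 + c^2)"
    by (simp add: algebra_simps power2_eq_square)
  finally show "energy \<kappa> p (cos \<theta>) * (sin (\<phi> \<theta>) * cos (\<phi> \<theta>))
      = \<kappa> * poly p (cos \<theta>) * (sin \<theta> * poly p' (cos \<theta>))"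
    by (simp add: E sc flip: s_def c_def A_def B_def)
qed

lemma poly_eq_0_iff_cos: "\<theta> \<in> {0..pi} \<Longrightarrow> poly p (cos \<theta>) = 0 \<longleftrightarrow> cos (\<phi> \<theta>) = 0"
  using energy_cos2[of \<theta>] energy_pos[of "cos \<theta>"] \<kappa> by auto

lemma pderiv_eq_0_iff_sin: "\<theta> \<in> {0<..<pi} \<Longrightarrow> poly p' (cos \<theta>) = 0 \<longleftrightarrow> sin (\<phi> \<theta>) = 0"
  using energy_sin2[of \<theta>] energy_pos[of "cos \<theta>"] sin_gt_zero[of \<theta>] by auto

definition angle :: "real \<Rightarrow> real" where "angle = the_inv_into {0..pi} \<phi>"

definition node :: "real \<Rightarrow> real" where "node t = cos (angle t)"

lemma phase_inj: "inj_on \<phi> {0..pi}"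
  by (rule linorder_inj_onI) (use phase_mono in fastforce)+

lemma phase_image: "\<phi> ` {0..pi} = {0..\<phi> pi}"
proof
  show "\<phi> ` {0..pi} \<subseteq> {0..\<phi> pi}"
  proof safe
    fix u assume "u \<in> {0..pi}"
    then show "\<phi> u \<in> {0..\<phi> pi}"
      using phase_mono[of 0 u] phase_mono[of u pi] phase_0
      by (cases "u = 0"; cases "u = pi") auto
  qed
  show "{0..\<phi> pi} \<subseteq> \<phi> ` {0..pi}"
    using IVT'[of \<phi> 0 _ pi] phase_cont phase_0 by force
qed

lemma angle_phase: "\<theta> \<in> {0..pi} \<Longrightarrow> angle (\<phi> \<theta>) = \<theta>"
  unfolding angle_def by (rule the_inv_into_f_f[OF phase_inj])

lemma phase_angle: "t \<in> {0..\<phi> pi} \<Longrightarrow> \<phi> (angle t) = t"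
  unfolding angle_def by (rule f_the_inv_into_f[OF phase_inj]) (simp add: phase_image)

lemma angle_in: "t \<in> {0..\<phi> pi} \<Longrightarrow> angle t \<in> {0..pi}"
  unfolding angle_def by (rule the_inv_into_into[OF phase_inj]) (simp_all add: phase_image)

lemma angle_0: "angle 0 = 0"
  using angle_phase[of 0] phase_0 by simp

lemma angle_in_interior: "t \<in> {0<..<\<phi> pi} \<Longrightarrow> angle t \<in> {0<..<pi}"
  using angle_in[of t] phase_angle[of t] phase_0 by (cases "angle t = 0"; cases "angle t = pi") auto

lemma angle_cont: "continuous_on {0..\<phi> pi} angle"
  unfolding angle_def phase_image[symmetric]
  by (rule continuous_on_inv_into[OF phase_cont _ phase_inj]) simp

lemma angle_deriv:
  assumes t: "t \<in> {0<..<\<phi> pi}"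
  shows "(angle has_real_derivative inverse (phase_speed a b \<kappa> p (node t))) (at t)"
proof (rule DERIV_inverse_function[where f = \<phi> and a = 0 and b = "\<phi> pi"])
  show "(\<phi> has_real_derivative phase_speed a b \<kappa> p (node t)) (at (angle t))"
    unfolding node_def using phase_deriv[of "angle t"] angle_in[of t] t by auto
  show "phase_speed a b \<kappa> p (node t) \<noteq> 0"
    using phase_speed_pos[of "node t"] by (simp add: node_def)
  show "isCont angle t"
    using continuous_on_interior[OF angle_cont, of t] t by simp
qed (use t phase_angle in auto)

lemma angle_mono: "0 \<le> s \<Longrightarrow> s < t \<Longrightarrow> t \<le> \<phi> pi \<Longrightarrow> angle s < angle t"
  using phase_mono[of "angle t" "angle s"] phase_angle[of s] phase_angle[of t]
    angle_in[of s] angle_in[of t]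
  by (cases "angle s" "angle t" rule: linorder_cases) auto

lemma node_antimono: "0 \<le> s \<Longrightarrow> s < t \<Longrightarrow> t \<le> \<phi> pi \<Longrightarrow> node t < node s"
  unfolding node_def
  using angle_mono[of s t] angle_in[of s] angle_in[of t] by (intro cos_monotone_0_pi) auto

lemma node_0: "node 0 = 1" by (simp add: node_def angle_0)

lemma node_end: "node (\<phi> pi) = -1" using angle_phase[of pi] by (simp add: node_def)

lemma node_phase_arccos:
  assumes "x \<in> {-1..1}"
  shows "\<phi> (arccos x) \<in> {0..\<phi> pi}" "node (\<phi> (arccos x)) = x"
proof -
  have "arccos x \<in> {0..pi}" using assms arccos_lbound arccos_ubound by auto
  then show "\<phi> (arccos x) \<in> {0..\<phi> pi}" "node (\<phi> (arccos x)) = x"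
    using phase_image angle_phase[of "arccos x"] assms by (auto simp: node_def)
qed

lemma node_inj: "inj_on node {0..\<phi> pi}"
  by (rule linorder_inj_onI) (use node_antimono in fastforce)+

lemma poly_node_eq_0_iff: "t \<in> {0..\<phi> pi} \<Longrightarrow> poly p (node t) = 0 \<longleftrightarrow> cos t = 0"
  using poly_eq_0_iff_cos[OF angle_in[of t]] by (simp add: phase_angle node_def)

lemma pderiv_node_eq_0_iff: "t \<in> {0<..<\<phi> pi} \<Longrightarrow> poly p' (node t) = 0 \<longleftrightarrow> sin t = 0"
  using pderiv_eq_0_iff_sin[OF angle_in_interior[of t]] by (simp add: phase_angle node_def)

lemma phase_pi_pos: "\<phi> pi > 0"
  using phase_mono[of 0 pi] phase_0 by simp

lemma phase_pi_multiple: obtains m :: nat where "\<phi> pi = real m * pi"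
proof -
  have "sin (\<phi> pi) = 0" using energy_sin2[of pi] energy_pos[of "-1"] by auto
  then obtain i :: int where i: "\<phi> pi = real_of_int i * pi" by (auto simp: sin_zero_iff_int2)
  then have "i > 0" using phase_pi_pos by (simp add: zero_less_mult_iff)
  then show ?thesis using i by (intro that[of "nat i"]) simp
qed

lemma node_image: "node ` {0<..<\<phi> pi} = {-1<..<1}"
proof
  show "node ` {0<..<\<phi> pi} \<subseteq> {-1<..<1}"
    using node_antimono[of 0] node_antimono[of _ "\<phi> pi"] by (auto simp: node_0 node_end)
  show "{-1<..<1} \<subseteq> node ` {0<..<\<phi> pi}"
  proof
    fix x :: real assume x: "x \<in> {-1<..<1}"
    then have "node (\<phi> (arccos x)) = x" "\<phi> (arccos x) \<in> {0..\<phi> pi}" using node_phase_arccos[of x] by auto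
    moreover from this x have "\<phi> (arccos x) \<noteq> 0" "\<phi> (arccos x) \<noteq> \<phi> pi" by (auto simp: node_0 node_end)
    ultimately show "x \<in> node ` {0<..<\<phi> pi}" by (intro image_eqI[of _ _ "\<phi> (arccos x)"]) auto
  qed
qed

lemma card_zeros:
  "\<phi> pi = real (card {x \<in> {-1<..<1}. poly p x = 0}) * pi"
  and card_pderiv_zeros:
  "\<phi> pi = (real (card {x \<in> {-1<..<1}. poly p' x = 0}) + 1) * pi"
proof -
  obtain m :: nat where m: "\<phi> pi = real m * pi" by (rule phase_pi_multiple)
  have m0: "m > 0" using phase_pi_pos m by (cases m) auto
  have sub: "{0<..<\<phi> pi} \<subseteq> {0..\<phi> pi}" by auto
  have "{x \<in> {-1<..<1}. poly p x = 0} = node ` {t \<in> {0<..<\<phi> pi}. cos t = 0}"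
    unfolding node_image[symmetric] using poly_node_eq_0_iff by auto
  then have 1: "card {x \<in> {-1<..<1}. poly p x = 0} = card {t \<in> {0<..<\<phi> pi}. cos t = 0}"
    by (simp add: card_image inj_on_subset[OF node_inj] Collect_mono_iff subset_eq)
  have "{t \<in> {0<..<\<phi> pi}. cos t = 0} = (\<lambda>j. real j * pi + pi / 2) ` {..<m}" (is "?L = ?R")
  proof (intro equalityI subsetI)
    fix t assume t: "t \<in> ?L"
    then obtain i :: int where i: "t = real_of_int i * pi + pi / 2"
      by (auto simp: cos_zero_iff_int2)
    have "(real_of_int i + 1/2) * pi > 0" "(real_of_int i + 1/2) * pi < real m * pi"
      using t i m by (auto simp: algebra_simps)
    then have "real_of_int i + 1/2 > 0" "real_of_int i + 1/2 < real m"
      by (simp_all add: zero_less_mult_iff)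
    then have "i \<ge> 0" "i < int m" by linarith+
    then show "t \<in> ?R" using i by (intro image_eqI[of _ _ "nat i"]) auto
  next
    fix t assume "t \<in> ?R"
    then obtain j where j: "t = (real j + 1/2) * pi" "j < m" by (auto simp: algebra_simps)
    have "t < real m * pi" unfolding j using j(2) by (intro mult_strict_right_mono) auto
    moreover have "cos t = 0" unfolding j by (simp add: algebra_simps cos_add)
    ultimately show "t \<in> ?L" using m j by (auto intro!: mult_pos_pos)
  qed
  then have "card {t \<in> {0<..<\<phi> pi}. cos t = 0} = m"
    by (simp add: card_image inj_on_def)
  with 1 m show "\<phi> pi = real (card {x \<in> {-1<..<1}. poly p x = 0}) * pi" by simp
  have "{x \<in> {-1<..<1}. poly p' x = 0} = node ` {t \<in> {0<..<\<phi> pi}. sin t = 0}"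
    unfolding node_image[symmetric] using pderiv_node_eq_0_iff by auto
  then have 2: "card {x \<in> {-1<..<1}. poly p' x = 0} = card {t \<in> {0<..<\<phi> pi}. sin t = 0}"
    by (simp add: card_image inj_on_subset[OF node_inj] Collect_mono_iff subset_eq)
  have "{t \<in> {0<..<\<phi> pi}. sin t = 0} = (\<lambda>j. real j * pi) ` {1..<m}" (is "?L = ?R")
  proof (intro equalityI subsetI)
    fix t assume t: "t \<in> ?L"
    then obtain i :: int where i: "t = real_of_int i * pi"
      by (auto simp: sin_zero_iff_int2)
    then have "i > 0" "real_of_int i < real m" using t m by (auto simp: zero_less_mult_iff)
    then show "t \<in> ?R" using i by (intro image_eqI[of _ _ "nat i"]) auto
  next
    fix t assume "t \<in> ?R"
    then show "t \<in> ?L" using m by auto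
  qed
  then have "card {t \<in> {0<..<\<phi> pi}. sin t = 0} = m - 1"
    by (simp add: card_image inj_on_def)
  with 2 m m0 show "\<phi> pi = (real (card {x \<in> {-1<..<1}. poly p' x = 0}) + 1) * pi"
    by (simp add: of_nat_diff)
qed

end

text \<open>
  A solution has one more zero in \<open>(-1, 1)\<close> than its derivative, which solves a Jacobi equation for the
  index \<open>n - 1\<close>; so both are counted by descending to the constant solutions.
\<close>

lemma card_zeros_eq_index:
  assumes "jacobi_ode a b (real n * (real n + a + b)) p" "a > 0" "b > 0" "p \<noteq> 0"
  shows "card {x \<in> {-1<..<1}. poly p x = 0} = n"
  using assms
proof (induction n arbitrary: a b p)
  case 0
  have "(2 * a + 1) * poly (pderiv p) 1 = 0"
    using jacobi_odeD[OF 0(1), of 1] by (simp add: drift_def)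
  then have "poly (pderiv p) 1 = 0" using 0 by auto
  then have "pderiv p = 0"
    using jacobi_ode_eq_0[OF jacobi_ode_pderiv[OF 0(1)], of 1] 0 by auto
  then obtain c where "p = [:c:]" by (metis degree_eq_zeroE pderiv_eq_0_iff)
  with 0 show ?case by simp
next
  case (Suc n)
  define l where "l = real (Suc n) * (real (Suc n) + a + b)"
  have l: "l > 0" using Suc.prems by (simp add: l_def add_nonneg_pos)
  interpret jacobi_solution a b "sqrt l" p
    using Suc.prems l by unfold_locales (auto simp: l_def)
  obtain \<phi> where "jacobi_phase a b (sqrt l) p \<phi>" using phase_exists by blast
  then interpret jacobi_phase a b "sqrt l" p \<phi> .
  have "pderiv p \<noteq> 0"
  proof
    assume "pderiv p = 0"
    then have "l * poly p 1 = 0" using jacobi_odeD[OF Suc.prems(1), of 1] by (simp add: l_def)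
    then have "p = 0" using l jacobi_ode_eq_0[OF Suc.prems(1-3), of 1] by auto
    with Suc.prems show False by simp
  qed
  moreover have "l - (a + b + 1) = real n * (real n + (a + 1) + (b + 1))"
    by (simp add: l_def algebra_simps)
  ultimately have "card {x \<in> {-1<..<1}. poly (pderiv p) x = 0} = n"
    using Suc.IH[of "a + 1" "b + 1" "pderiv p"] jacobi_ode_pderiv[OF Suc.prems(1)] Suc.prems
    by (simp add: l_def)
  with card_zeros card_pderiv_zeros
  have "real (card {x \<in> {-1<..<1}. poly p x = 0}) = real (Suc n)"
    by (metis (no_types, lifting) mult_right_cancel of_nat_Suc pi_neq_zero add.commute)
  then show ?case by (simp only: of_nat_eq_iff)
qed

section \<open>Damping and amplitude as functions of the phase\<close>

text \<open>
  With \<open>X = a cot(\<theta>/2) / \<kappa>\<close> and \<open>w = b tan(\<theta>/2) / \<kappa>\<close> the damping relative to the frequency is \<open>(X - w)/2\<close>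
  and the product \<open>X w = a b / \<kappa>\<^sup>2\<close> does not depend on \<open>\<theta>\<close>. The function below is the rate at
  which the damping decreases, \<open>- g'(\<theta>) / \<kappa>\<^sup>2\<close>, in these terms.
\<close>

definition damping_decay :: "real \<Rightarrow> real \<Rightarrow> real \<Rightarrow> real \<Rightarrow> real" where
  "damping_decay a b X w = (X + w) * (X / a + w / b) / 4"

lemma damping_decay_less_if_damping_eq:
  assumes "a > 0" "b > 0" "X1 > 0" "w1 > 0" "X2 > 0" "w2 > 0"
    and prod: "X2 * w2 < X1 * w1" and diff: "X1 - w1 = X2 - w2"
  shows "damping_decay a b X2 w2 < damping_decay a b X1 w1"
proof -
  have "X2 < X1"
  proof (rule ccontr)
    assume "\<not> X2 < X1"
    then have "X1 * w1 \<le> X2 * w2" using assms by (intro mult_mono) auto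
    with prod show False by simp
  qed
  moreover from this have "w2 < w1" using diff by simp
  ultimately show ?thesis unfolding damping_decay_def using assms
    by (intro divide_strict_right_mono mult_strict_mono add_strict_mono) (auto intro!: add_pos_pos)
qed

text \<open>
  For a fixed product \<open>c = X w\<close> the decay is increasing in \<open>X\<close> only where \<open>a c\<^sup>2 \<le> b X\<^sup>4\<close>, that is, for \<open>\<theta>\<close>
  close to \<open>0\<close>.
\<close>

lemma damping_decay_less_if_damping_le:
  assumes ab: "a > 0" "b > 0" and pos: "X1 > 0" "w1 > 0" "X2 > 0" "w2 > 0"
    and prod: "X2 * w2 < X1 * w1" and diff: "X2 - w2 \<le> X1 - w1"
    and large: "a * (X1 * w1)^2 \<le> b * X2 ^ 4"
  shows "damping_decay a b X2 w2 < damping_decay a b X1 w1"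
proof -
  have X: "X2 \<le> X1"
  proof (rule ccontr)
    assume n: "\<not> X2 \<le> X1"
    then have "X1 * w1 < X2 * w2" using pos diff by (intro mult_strict_mono) auto
    with prod show False by simp
  qed
  define c u where "c = X1 * w1" and "u = c / X2"
  have c: "c > 0" using pos by (simp add: c_def)
  have w1: "w1 = c / X1" using pos by (simp add: c_def)
  have u: "w2 < u" using prod pos by (simp add: u_def c_def field_simps)
  have "b * X2^4 \<le> b * (X1^2 * X2^2)"
    using X pos ab power_mono[of X2 X1 2] by (intro mult_left_mono) (auto simp: power4_eq_xxxx power2_eq_square mult.assoc[symmetric] intro!: mult_mono)
  then have "a * c^2 \<le> b * (X1^2 * X2^2)" using large by (simp add: c_def)
  moreover have "0 \<le> X1^2 - X2^2" using X pos power_mono[of X2 X1 2] by simp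
  ultimately have "0 \<le> (b * (X1^2 * X2^2) - a * c^2) * (X1^2 - X2^2) / (a * b * (X1^2 * X2^2))"
    using ab by (intro divide_nonneg_nonneg mult_nonneg_nonneg) auto
  also have "\<dots> = X1^2 / a + w1^2 / b - (X2^2 / a + u^2 / b)"
    unfolding u_def w1 using ab pos by (simp add: field_simps power2_eq_square)
  finally have "X2^2 / a + u^2 / b \<le> X1^2 / a + w1^2 / b" by simp
  moreover have "w2^2 / b < u^2 / b"
    using u pos ab by (intro divide_strict_right_mono power_strict_mono) auto
  moreover have "X2 * w2 * (1/a + 1/b) < X1 * w1 * (1/a + 1/b)"
    using prod ab by (intro mult_strict_right_mono) (auto intro!: add_pos_pos)
  moreover have "4 * damping_decay a b X w = X^2 / a + w^2 / b + X * w * (1/a + 1/b)" for X w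
    using ab by (simp add: damping_decay_def field_simps power2_eq_square)
  ultimately show ?thesis by (smt (verit))
qed

context jacobi_phase
begin

definition cot_part :: "real \<Rightarrow> real" where
  "cot_part t = a * (1 + node t) / (\<kappa> * sin (angle t))"

definition tan_part :: "real \<Rightarrow> real" where
  "tan_part t = b * (1 - node t) / (\<kappa> * sin (angle t))"

definition damping :: "real \<Rightarrow> real" where
  "damping t = drift a b (node t) / (\<kappa> * sin (angle t))"

definition amplitude :: "real \<Rightarrow> real" where
  "amplitude t = ln (energy \<kappa> p (node t) / \<kappa>^2)"

lemma sin_angle_pos: "t \<in> {0<..<\<phi> pi} \<Longrightarrow> sin (angle t) > 0"
  using angle_in_interior[of t] sin_gt_zero by auto

lemma node_in: "node t \<in> {-1..1}" by (simp add: node_def)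

lemma damping_eq: "damping t = (cot_part t - tan_part t) / 2"
  by (simp add: damping_def cot_part_def tan_part_def drift_def field_simps flip: diff_divide_distrib)

lemma parts_pos:
  assumes "t \<in> {0<..<\<phi> pi}"
  shows "cot_part t > 0" "tan_part t > 0"
proof -
  have "node t \<in> {-1<..<1}" using assms node_image by blast
  then show "cot_part t > 0" "tan_part t > 0"
    using a b \<kappa> sin_angle_pos[OF assms] by (auto simp: cot_part_def tan_part_def)
qed

lemma parts_prod:
  assumes "t \<in> {0<..<\<phi> pi}"
  shows "cot_part t * tan_part t = a * b / \<kappa>^2"
proof -
  have "(1 + node t) * (1 - node t) = (sin (angle t))^2"
    by (simp add: node_def sin_squared_eq algebra_simps power2_eq_square)
  then have "cot_part t * tan_part t = a * b * (sin (angle t))^2 / (\<kappa> * sin (angle t))^2"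
    by (simp add: cot_part_def tan_part_def power2_eq_square mult_ac)
  then show ?thesis using sin_angle_pos[OF assms] by (simp add: power_mult_distrib)
qed

lemma damping_slope_eq:
  assumes "t \<in> {0<..<\<phi> pi}"
  shows "damping_slope a b (node t) / (\<kappa> * sin (angle t))^2 = damping_decay a b (cot_part t) (tan_part t)"
proof -
  define s x where "s = \<kappa> * sin (angle t)" and "x = node t"
  have "s > 0" using sin_angle_pos[OF assms] \<kappa> by (simp add: s_def)
  then show ?thesis using a b
    by (simp add: damping_decay_def cot_part_def tan_part_def damping_slope_def power2_eq_square
        flip: s_def x_def) (simp add: field_simps)
qed

lemma phase_speed_node:
  assumes "t \<in> {0<..<\<phi> pi}"
  shows "phase_speed a b \<kappa> p (node t) = \<kappa> * (1 - damping t * sin (2 * t))"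
proof -
  define E where "E = energy \<kappa> p (node t)"
  have E: "E \<noteq> 0" using energy_pos[OF node_in, of t] by (simp add: E_def)
  have s: "sin (angle t) \<noteq> 0" using sin_angle_pos[OF assms] by simp
  have "E * (sin t * cos t) = \<kappa> * poly p (node t) * (sin (angle t) * poly p' (node t))"
    using energy_sin_cos[OF angle_in[of t]] phase_angle[of t] assms by (simp add: E_def node_def)
  then have "sin t * cos t = \<kappa> * poly p (node t) * (sin (angle t) * poly p' (node t)) / E"
    using E by (simp add: field_simps)
  then have "damping t * sin (2 * t) = 2 * drift a b (node t) * poly p (node t) * poly p' (node t) / E"
    unfolding sin_double mult.assoc using s \<kappa> by (simp add: damping_def field_simps)
  then show ?thesis by (simp add: phase_speed_def E_def)
qed

lemma flow_pos:
  assumes "t \<in> {0<..<\<phi> pi}"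
  shows "1 - damping t * sin (2 * t) > 0"
  using phase_speed_pos[OF node_in, of t] phase_speed_node[OF assms] \<kappa> by (simp add: zero_less_mult_iff)

lemma damping_deriv:
  assumes t: "t \<in> {0<..<\<phi> pi}"
  shows "(damping has_real_derivative
    - damping_decay a b (cot_part t) (tan_part t) / (1 - damping t * sin (2 * t))) (at t)"
proof -
  define s x where "s = sin (angle t)" and "x = cos (angle t)"
  have s: "s > 0" using sin_angle_pos[OF t] by (simp add: s_def)
  define v where "v = phase_speed a b \<kappa> p (node t)"
  have "((\<lambda>\<theta>. drift a b (cos \<theta>) / (\<kappa> * sin \<theta>)) has_real_derivative
      ((a + b) / 2 * (- s) * (\<kappa> * s) - drift a b x * (\<kappa> * x)) / (\<kappa> * s * (\<kappa> * s))) (at (angle t))"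
    unfolding s_def x_def drift_def
    using sin_angle_pos[OF t] \<kappa> by (auto intro!: derivative_eq_intros simp: field_simps)
  moreover have "(a + b) / 2 * (- s) * (\<kappa> * s) - drift a b x * (\<kappa> * x) = - \<kappa> * damping_slope a b x"
  proof -
    have ss: "s * s = 1 - x * x"
      by (simp add: s_def x_def sin_squared_eq flip: power2_eq_square)
    have "(a + b) / 2 * (- s) * (\<kappa> * s) - drift a b x * (\<kappa> * x)
        = - \<kappa> * ((a + b) / 2 * (s * s) + drift a b x * x)"
      by (simp add: algebra_simps)
    also have "(a + b) / 2 * (s * s) + drift a b x * x = damping_slope a b x"
      unfolding ss by (simp add: drift_def damping_slope_def field_simps)
    finally show ?thesis .
  qed
  ultimately have "((\<lambda>\<theta>. drift a b (cos \<theta>) / (\<kappa> * sin \<theta>)) has_real_derivative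
      - \<kappa> * (damping_slope a b x / (\<kappa> * s)^2)) (at (angle t))"
    by (simp add: power2_eq_square)
  from DERIV_chain2[OF this angle_deriv[OF t]]
  have der: "(damping has_real_derivative - \<kappa> * (damping_slope a b x / (\<kappa> * s)^2) * inverse v) (at t)"
    by (simp add: damping_def[abs_def] node_def v_def)
  have decay: "damping_slope a b x / (\<kappa> * s)^2 = damping_decay a b (cot_part t) (tan_part t)"
    using damping_slope_eq[OF t] by (simp add: x_def s_def node_def)
  have v: "v = \<kappa> * (1 - damping t * sin (2 * t))"
    unfolding v_def by (rule phase_speed_node[OF t])
  show ?thesis
    by (rule DERIV_cong[OF der], unfold decay v) (use \<kappa> flow_pos[OF t] in \<open>simp add: divide_inverse\<close>)
qed

lemma amplitude_deriv:
  assumes t: "t \<in> {0<..<\<phi> pi}"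
  shows "(amplitude has_real_derivative
    - 4 * (sin t)^2 * (damping t / (1 - damping t * sin (2 * t)))) (at t)"
proof -
  define s x E v where "s = sin (angle t)" and "x = cos (angle t)" and "E = energy \<kappa> p x"
    and "v = phase_speed a b \<kappa> p (node t)"
  have s: "s > 0" using sin_angle_pos[OF t] by (simp add: s_def)
  have E: "E > 0" using energy_pos[OF node_in] by (simp add: E_def x_def node_def)
  have v: "v = \<kappa> * (1 - damping t * sin (2 * t))"
    unfolding v_def by (rule phase_speed_node[OF t])
  have v0: "v > 0" unfolding v_def by (rule phase_speed_pos[OF node_in])
  have "E * (sin t)^2 = (s * poly p' x)^2"
    using energy_sin2[OF angle_in[of t]] phase_angle[of t] t by (simp add: E_def x_def s_def)
  then have 1: "(sin t)^2 = s^2 * poly p' x ^ 2 / E" using E by (simp add: field_simps)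
  have "((\<lambda>t. energy \<kappa> p (cos (angle t))) has_real_derivative
      (- 4 * drift a b x * s * poly p' x ^ 2) * inverse v) (at t)"
    using DERIV_chain2[OF energy_deriv angle_deriv[OF t]] by (simp add: s_def x_def v_def)
  then have der: "((\<lambda>t. energy \<kappa> p (cos (angle t)) / \<kappa>^2) has_real_derivative
      (- 4 * drift a b x * s * poly p' x ^ 2) * inverse v / \<kappa>^2) (at t)"
    by (rule DERIV_cdivide)
  have "((\<lambda>t. ln (energy \<kappa> p (cos (angle t)) / \<kappa>^2)) has_real_derivative
      1 / (E / \<kappa>^2) * ((- 4 * drift a b x * s * poly p' x ^ 2) * inverse v / \<kappa>^2)) (at t)"
    by (rule DERIV_chain2[where f = ln, OF _ der], unfold E_def x_def, rule DERIV_ln_divide)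
      (use E \<kappa> in \<open>simp add: E_def x_def\<close>)
  then have "(amplitude has_real_derivative
      1 / (E / \<kappa>^2) * ((- 4 * drift a b x * s * poly p' x ^ 2) * inverse v / \<kappa>^2)) (at t)"
    by (simp only: amplitude_def[abs_def] node_def)
  moreover have "1 / (E / \<kappa>^2) * ((- 4 * drift a b x * s * poly p' x ^ 2) * inverse v / \<kappa>^2)
    = - 4 * (sin t)^2 * (damping t * \<kappa> / v)"
    unfolding 1 using E \<kappa> s v0
    by (simp add: damping_def node_def field_simps power2_eq_square flip: s_def x_def)
  moreover have "damping t * \<kappa> / v = damping t / (1 - damping t * sin (2 * t))"
    unfolding v using \<kappa> by simp
  ultimately show ?thesis by simp
qed

lemma amplitude_cont: "continuous_on {0..\<phi> pi} amplitude"
proof -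
  have "energy \<kappa> p (node t) / \<kappa>^2 \<noteq> 0" for t
    using energy_pos[OF node_in, of t] \<kappa> by simp
  then show ?thesis
    unfolding amplitude_def[abs_def] energy_def node_def
    by (intro continuous_intros angle_cont) (auto simp: energy_def node_def)
qed

lemma amplitude_0: "amplitude 0 = ln (poly p 1 ^ 2)"
  using \<kappa> by (simp add: amplitude_def node_0 energy_def)

lemma amplitude_at_extremum:
  assumes t: "t \<in> {0..\<phi> pi}" and "sin t = 0"
  shows "amplitude t = ln (poly p (node t) ^ 2)" "poly p (node t) \<noteq> 0"
proof -
  have "(sin (angle t) * poly p' (node t))^2 = 0"
    using energy_sin2[OF angle_in[OF t]] phase_angle[OF t] assms by (simp add: node_def)
  then have E: "energy \<kappa> p (node t) = \<kappa>^2 * poly p (node t) ^ 2"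
    by (simp only: node_def energy_cos) (simp add: power_mult_distrib)
  then show "amplitude t = ln (poly p (node t) ^ 2)" using \<kappa> by (simp add: amplitude_def)
  show "poly p (node t) \<noteq> 0" using E energy_pos[OF node_in, of t] by auto
qed

lemma angle_at_right_0: "filterlim angle (at_right 0) (at_right 0)"
proof -
  have "(angle \<longlongrightarrow> 0) (at 0 within {0..\<phi> pi})"
    using angle_cont phase_pi_pos by (metis angle_0 atLeastAtMost_iff continuous_on_def less_eq_real_def)
  then have "(angle \<longlongrightarrow> 0) (at_right 0)"
    using phase_pi_pos by (simp add: at_within_Icc_at_right)
  moreover have "\<forall>\<^sub>F t in at_right 0. angle t \<in> {0<..} \<and> angle t \<noteq> 0"
    unfolding eventually_at_right_field
    using angle_in_interior phase_pi_pos by (intro exI[of _ "\<phi> pi"]) force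
  ultimately show ?thesis by (simp add: filterlim_at)
qed

lemma cot_part_at_top: "filterlim cot_part at_top (at_right 0)"
proof -
  have ang: "(angle \<longlongrightarrow> 0) (at_right 0)"
    using angle_at_right_0 by (simp add: filterlim_at)
  have "((\<lambda>t. a * (1 + cos (angle t))) \<longlongrightarrow> a * (1 + cos 0)) (at_right 0)"
    by (intro tendsto_intros ang)
  moreover have "((\<lambda>t. \<kappa> * sin (angle t)) \<longlongrightarrow> \<kappa> * sin 0) (at_right 0)"
    by (intro tendsto_intros ang)
  moreover have "\<forall>\<^sub>F t in at_right 0. \<kappa> * sin (angle t) > 0"
    unfolding eventually_at_right_field
    using sin_angle_pos phase_pi_pos \<kappa> by (intro exI[of _ "\<phi> pi"]) force
  ultimately show ?thesis
    unfolding cot_part_def[abs_def] node_def using a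
    by (intro LIM_at_top_divide[of _ "a * (1 + cos 0)"]) auto
qed

text \<open>
  At phase \<open>0\<close> the damping has a pole with a principal part that does not depend on \<open>\<kappa>\<close>. This is where
  the regularity of the solution at \<open>x = 1\<close> enters: it fixes \<open>p'(1) / p(1)\<close>.
\<close>

lemma damping_principal_part:
  "((\<lambda>t. damping t - a / (2 * a + 1) * cos t / sin t) \<longlongrightarrow> 0) (at_right 0)"
proof -
  have p1: "poly p' 1 \<noteq> 0"
  proof
    assume 0: "poly p' 1 = 0"
    then have "poly p 1 = 0" using deriv_at_1 \<kappa> by simp
    then show False using jacobi_ode_eq_0[OF ode a b, of 1] p by simp
  qed
  define K where "K x = drift a b x / \<kappa> - a / (2 * a + 1) * (\<kappa> * poly p x / poly p' x)" for x
  have "\<kappa> * poly p 1 / poly p' 1 = (2 * a + 1) / \<kappa>"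
    using deriv_at_1 p1 \<kappa> by (simp add: field_simps power2_eq_square)
  moreover have "drift a b 1 = a" by (simp add: drift_def)
  ultimately have K1: "K 1 = 0" unfolding K_def using a by simp
  obtain D where "(K has_real_derivative D) (at (cos 0))"
  proof -
    have "\<exists>D. (K has_real_derivative D) (at 1)"
      unfolding K_def drift_def by (rule exI) (rule derivative_eq_intros poly_DERIV refl p1 | simp add: p1 \<kappa> less_imp_neq[symmetric])+
    then show ?thesis using that by auto
  qed
  from DERIV_chain2[OF this DERIV_cos]
  have "((\<lambda>\<theta>. K (cos \<theta>) / \<theta>) \<longlongrightarrow> 0) (at 0)"
    by (simp add: has_field_derivative_iff K1)
  moreover have "((\<lambda>\<theta>. sin \<theta> / \<theta>) \<longlongrightarrow> 1) (at (0::real))"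
    using DERIV_sin[of "0::real"] by (simp add: has_field_derivative_iff)
  ultimately have "((\<lambda>\<theta>. (K (cos \<theta>) / \<theta>) / (sin \<theta> / \<theta>)) \<longlongrightarrow> 0 / 1) (at 0)"
    by (rule tendsto_divide) simp
  then have "((\<lambda>\<theta>. (K (cos \<theta>) / \<theta>) / (sin \<theta> / \<theta>)) \<longlongrightarrow> 0) (at_right 0)"
    using filterlim_at_split by auto
  from filterlim_compose[OF this angle_at_right_0]
  have lim: "((\<lambda>t. (K (cos (angle t)) / angle t) / (sin (angle t) / angle t)) \<longlongrightarrow> 0) (at_right 0)" .
  have "(K (cos (angle t)) / angle t) / (sin (angle t) / angle t)
      = damping t - a / (2 * a + 1) * cos t / sin t" if t: "0 < t" "t < min pi (\<phi> pi)" for t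
  proof -
    have tin: "t \<in> {0<..<\<phi> pi}" using t by simp
    have st: "sin t \<noteq> 0" using t sin_gt_zero[of t] by simp
    have s: "sin (angle t) \<noteq> 0" using sin_angle_pos[OF tin] by simp
    have ang: "angle t \<noteq> 0" using angle_in_interior[OF tin] by simp
    have p': "poly p' (node t) \<noteq> 0" using pderiv_node_eq_0_iff[OF tin] st by simp
    have "\<kappa> * poly p (node t) * sin t = sin (angle t) * poly p' (node t) * cos t"
      using phase_polar[OF angle_in[of t]] phase_angle[of t] tin by (simp add: node_def)
    then have ct: "cos t / sin t = \<kappa> * poly p (node t) / poly p' (node t) / sin (angle t)"
      using s st p' by (simp add: field_simps)
    have "(K (cos (angle t)) / angle t) / (sin (angle t) / angle t) = K (node t) / sin (angle t)"
      using ang by (simp add: node_def)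
    also have "\<dots> = damping t - a / (2 * a + 1) * (\<kappa> * poly p (node t) / poly p' (node t) / sin (angle t))"
      unfolding K_def damping_def by (simp add: diff_divide_distrib)
    finally show ?thesis by (simp only: ct[symmetric] times_divide_eq_right)
  qed
  then have "\<forall>\<^sub>F t in at_right 0. (K (cos (angle t)) / angle t) / (sin (angle t) / angle t)
      = damping t - a / (2 * a + 1) * cos t / sin t"
    unfolding eventually_at_right_field
    using phase_pi_pos by (intro exI[of _ "min pi (\<phi> pi)"]) auto
  from tendsto_cong[OF this] lim show ?thesis by simp
qed

end

section \<open>Comparison of two solutions at equal phase\<close>

locale jacobi_pair =
  S1: jacobi_phase a b \<kappa>1 p1 \<phi>1 + S2: jacobi_phase a b \<kappa>2 p2 \<phi>2
  for a b \<kappa>1 p1 \<phi>1 \<kappa>2 p2 \<phi>2 +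
  assumes \<kappa>_less: "\<kappa>1 < \<kappa>2" and phase_pi_le: "\<phi>1 pi \<le> \<phi>2 pi"
begin

text \<open>
  The difference of the two dampings tends to \<open>0\<close> at phase \<open>0\<close>. At small phases a damping belonging to
  \<open>\<kappa>2\<close> that is not the larger one also decays more slowly, so the difference could not have come
  from \<open>0\<close>. At later phases only equal dampings are compared, which excludes a downward crossing.
\<close>

lemma damping_less:
  assumes t: "t \<in> {0<..<\<phi>1 pi}"
  shows "S1.damping t < S2.damping t"
proof -
  define \<delta> where "\<delta> t = S2.damping t - S1.damping t" for t
  define \<delta>' where "\<delta>' t =
      damping_decay a b (S1.cot_part t) (S1.tan_part t) / (1 - S1.damping t * sin (2 * t))
    - damping_decay a b (S2.cot_part t) (S2.tan_part t) / (1 - S2.damping t * sin (2 * t))" for t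
  have in2: "t \<in> {0<..<\<phi>2 pi}" if "t \<in> {0<..<\<phi>1 pi}" for t using that phase_pi_le by auto
  have der: "(\<delta> has_real_derivative \<delta>' t) (at t)" if "t \<in> {0<..<\<phi>1 pi}" for t
    unfolding \<delta>_def \<delta>'_def
    by (rule DERIV_cong[OF DERIV_diff[OF S2.damping_deriv[OF in2[OF that]] S1.damping_deriv[OF that]]]) simp
  have prod: "S2.cot_part t * S2.tan_part t < S1.cot_part t * S1.tan_part t"
    if "t \<in> {0<..<\<phi>1 pi}" for t
    unfolding S1.parts_prod[OF that] S2.parts_prod[OF in2[OF that]]
    using S1.a S1.b S1.\<kappa> \<kappa>_less
    by (intro divide_strict_left_mono power_strict_mono mult_pos_pos zero_less_power) auto
  have cross: "\<delta>' t > 0" if t: "t \<in> {0<..<\<phi>1 pi}" and 0: "\<delta> t = 0" for t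
  proof -
    have d: "S2.damping t = S1.damping t" using 0 by (simp add: \<delta>_def)
    then have "S1.cot_part t - S1.tan_part t = S2.cot_part t - S2.tan_part t"
      by (simp add: S1.damping_eq S2.damping_eq)
    then have "damping_decay a b (S2.cot_part t) (S2.tan_part t)
        < damping_decay a b (S1.cot_part t) (S1.tan_part t)"
      using damping_decay_less_if_damping_eq[OF S1.a S1.b S1.parts_pos[OF t] S2.parts_pos[OF in2[OF t]]]
        prod[OF t] by simp
    then show ?thesis unfolding \<delta>'_def d using S1.flow_pos[OF t]
      by (simp add: divide_strict_right_mono)
  qed
  \<comment> \<open>From \<open>X \<ge> K\<close> one gets \<open>X\<^sup>4 \<ge> X\<close>, hence the lower bound on \<open>b X\<^sup>4\<close> required near phase \<open>0\<close>.\<close>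
  define K where "K = max 1 (a * (a * b / \<kappa>1^2)^2 / b)"
  have "\<forall>\<^sub>F t in at_right 0. K \<le> S2.cot_part t"
    using S2.cot_part_at_top by (simp add: filterlim_at_top)
  then obtain e where e: "e > 0" "\<And>t. 0 < t \<Longrightarrow> t < e \<Longrightarrow> K \<le> S2.cot_part t"
    unfolding eventually_at_right_field by auto
  define L where "L = min e (min (pi / 2) (\<phi>1 pi))"
  have L: "L > 0" "L \<le> e" "L \<le> pi / 2" "L \<le> \<phi>1 pi" using e S1.phase_pi_pos by (auto simp: L_def)
  have up: "\<delta>' t > 0" if t: "0 < t" "t < L" and neg: "\<delta> t \<le> 0" for t
  proof -
    have in1: "t \<in> {0<..<\<phi>1 pi}" using t L by auto
    let ?c = "S1.cot_part t * S1.tan_part t"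
    have X: "1 \<le> S2.cot_part t" "a * ?c^2 / b \<le> S2.cot_part t"
      using e(2)[of t] t L S1.parts_prod[OF in1] by (auto simp: K_def)
    have "S2.cot_part t \<le> S2.cot_part t ^ 4" using X(1) by (rule self_le_power) simp
    with X(2) have "a * ?c^2 / b \<le> S2.cot_part t ^ 4" by simp
    then have large: "a * ?c^2 \<le> b * S2.cot_part t ^ 4" using S1.b by (simp add: field_simps)
    have "damping_decay a b (S2.cot_part t) (S2.tan_part t)
        < damping_decay a b (S1.cot_part t) (S1.tan_part t)"
      using damping_decay_less_if_damping_le[OF S1.a S1.b S1.parts_pos[OF in1]
          S2.parts_pos[OF in2[OF in1]] prod[OF in1] _ large] neg
      by (simp add: \<delta>_def S1.damping_eq S2.damping_eq)
    moreover have "sin (2 * t) > 0" using t L by (intro sin_gt_zero) auto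
    then have "S2.damping t * sin (2 * t) \<le> S1.damping t * sin (2 * t)"
      using neg by (simp add: \<delta>_def)
    moreover have "damping_decay a b (S2.cot_part t) (S2.tan_part t) > 0"
      unfolding damping_decay_def
      using S2.parts_pos[OF in2[OF in1]] S1.a S1.b by (auto intro!: add_pos_pos mult_pos_pos)
    ultimately have "damping_decay a b (S2.cot_part t) (S2.tan_part t) / (1 - S2.damping t * sin (2 * t))
      < damping_decay a b (S1.cot_part t) (S1.tan_part t) / (1 - S1.damping t * sin (2 * t))"
      using S1.flow_pos[OF in1] by (intro frac_less) auto
    then show ?thesis by (simp add: \<delta>'_def)
  qed
  have lim: "(\<delta> \<longlongrightarrow> 0) (at_right 0)"
    using tendsto_diff[OF S2.damping_principal_part S1.damping_principal_part]
    by (simp add: \<delta>_def[abs_def])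
  have start: "\<delta> t > 0" if "0 < t" "t < L" for t
    using positive_if_starts_at_zero[of L \<delta> \<delta>', OF der up lim that] L by auto
  have "\<delta> t > 0"
  proof (cases "t < L")
    case True then show ?thesis using start t by auto
  next
    case False
    then show ?thesis
      using positive_if_upward_crossings[of "L / 2" "\<phi>1 pi" \<delta> \<delta>' t] der cross start[of "L / 2"] t L
      by auto
  qed
  then show ?thesis by (simp add: \<delta>_def)
qed

text \<open>
  The logarithmic decrement of the energy per unit of phase, \<open>4 h (sin t)\<^sup>2 / (1 - h sin 2t)\<close>,
  is increasing in the damping \<open>h\<close>.
\<close>

lemma amplitude_less:
  assumes init: "poly p1 1 ^ 2 = poly p2 1 ^ 2" and t: "pi \<le> t" "t \<le> \<phi>1 pi"
  shows "S2.amplitude t < S1.amplitude t"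
proof -
  define A where "A t = S2.amplitude t - S1.amplitude t" for t
  define r where "r h t = h / (1 - h * sin (2 * t))" for h t :: real
  have der: "\<exists>y. (A has_real_derivative y) (at t) \<and> y \<le> 0 \<and> (sin t \<noteq> 0 \<longrightarrow> y < 0)"
    if t: "t \<in> {0<..<\<phi>1 pi}" for t
  proof (intro exI conjI impI)
    have in2: "t \<in> {0<..<\<phi>2 pi}" using t phase_pi_le by auto
    let ?y = "4 * (sin t)^2 * (r (S1.damping t) t - r (S2.damping t) t)"
    show "(A has_real_derivative ?y) (at t)"
      unfolding A_def r_def
      by (rule DERIV_cong[OF DERIV_diff[OF S2.amplitude_deriv[OF in2] S1.amplitude_deriv[OF t]]])
        (simp add: algebra_simps)
    have r: "r (S1.damping t) t < r (S2.damping t) t"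
      unfolding r_def using S1.flow_pos[OF t] S2.flow_pos[OF in2] damping_less[OF t]
      by (simp add: divide_simps) (simp add: algebra_simps)
    then show "?y \<le> 0" by (simp add: mult_nonneg_nonpos)
    show "?y < 0" if "sin t \<noteq> 0" using r that by (simp add: mult_pos_neg)
  qed
  have cont: "continuous_on {u..v} A" if "0 \<le> u" "v \<le> \<phi>1 pi" for u v
    unfolding A_def using that phase_pi_le
    by (intro continuous_on_diff continuous_on_subset[OF S1.amplitude_cont]
        continuous_on_subset[OF S2.amplitude_cont]) auto
  \<comment> \<open>Strictness comes from the first half turn, which lies before every maximum compared.\<close>
  have "A pi < A 0"
  proof (rule DERIV_neg_imp_decreasing_open[where f = A])
    show "\<exists>y. (A has_real_derivative y) (at x) \<and> y < 0" if "0 < x" "x < pi" for x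
      using der[of x] sin_gt_zero[of x] that t by force
  qed (use cont t in auto)
  moreover have "A 0 = 0" by (simp add: A_def S1.amplitude_0 S2.amplitude_0 init)
  moreover have "A t \<le> A pi"
  proof (rule DERIV_nonpos_imp_decreasing_open[where f = A])
    show "\<exists>y. (A has_real_derivative y) (at x) \<and> y \<le> 0" if "pi < x" "x < t" for x
      using der[of x] that t pi_gt_zero by force
  qed (use cont t in auto)
  ultimately show ?thesis by (simp add: A_def)
qed

lemma extrema_less:
  assumes init: "poly p1 1 ^ 2 = poly p2 1 ^ 2" and k: "1 \<le> k" "real k * pi \<le> \<phi>1 pi"
  shows "\<bar>poly p2 (S2.node (real k * pi))\<bar> < \<bar>poly p1 (S1.node (real k * pi))\<bar>"
proof -
  let ?t = "real k * pi"
  have "pi \<le> ?t" using k by simp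
  then have "S2.amplitude ?t < S1.amplitude ?t" using amplitude_less[OF init] k by simp
  moreover have "?t \<in> {0..\<phi>1 pi}" "?t \<in> {0..\<phi>2 pi}" using k phase_pi_le by auto
  ultimately have "poly p2 (S2.node ?t) ^ 2 < poly p1 (S1.node ?t) ^ 2"
    using S1.amplitude_at_extremum[of ?t] S2.amplitude_at_extremum[of ?t] by simp
  then show ?thesis
    using abs_le_square_iff[of "poly p1 (S1.node ?t)" "poly p2 (S2.node ?t)"] by linarith
qed

end

section \<open>Relative maxima\<close>

lemma rel_max_on_mult:
  assumes "c > 0"
  shows "rel_max_on S (\<lambda>x. c * f x) = rel_max_on S f"
  using assms by (simp add: rel_max_on_def)

context jacobi_phase
begin

text \<open>
  As a function of the phase \<open>t\<close>, \<open>p\<^sup>2\<close> has a derivative of the sign of \<open>- sin 2t\<close>. This covers the endpoints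
  as well as the interior maxima.
\<close>

lemma square_le_at_extremum:
  assumes s: "s \<in> {0..\<phi> pi}" "sin s = 0" and t: "t \<in> {0..\<phi> pi}" "\<bar>t - s\<bar> \<le> pi / 2"
  shows "poly p (node t) ^ 2 \<le> poly p (node s) ^ 2"
proof -
  define f where "f t = poly p (node t) ^ 2" for t
  have der: "\<exists>c>0. (f has_real_derivative - c * sin (2 * (u - s))) (at u)" if u: "u \<in> {0<..<\<phi> pi}" for u
  proof -
    define E v where "E = energy \<kappa> p (node u)" and "v = phase_speed a b \<kappa> p (node u)"
    have Ev: "E > 0" "v > 0" using energy_pos[OF node_in] phase_speed_pos[OF node_in] by (auto simp: E_def v_def)
    have "(f has_real_derivative
        2 * poly p (node u) * (poly p' (node u) * (- sin (angle u) * inverse v))) (at u)"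
      unfolding f_def node_def v_def
      by (auto intro!: derivative_eq_intros DERIV_chain2[OF poly_DERIV] angle_deriv[OF u, unfolded node_def])
    moreover have "E * (sin u * cos u) = \<kappa> * poly p (node u) * (sin (angle u) * poly p' (node u))"
      using energy_sin_cos[OF angle_in[of u]] phase_angle[of u] u by (simp add: E_def node_def)
    then have "2 * poly p (node u) * (poly p' (node u) * (- sin (angle u) * inverse v))
        = - (E / (\<kappa> * v)) * sin (2 * u)"
      unfolding sin_double using \<kappa> Ev by (simp add: field_simps)
    moreover have "sin (2 * u) = sin (2 * (u - s))"
      using s(2) cos_double_sin[of s] by (simp add: right_diff_distrib sin_diff sin_double[of s])
    ultimately show ?thesis using Ev \<kappa> by (intro exI[of _ "E / (\<kappa> * v)"]) simp
  qed
  have "continuous_on {0..\<phi> pi} f"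
    unfolding f_def node_def by (intro continuous_intros angle_cont)
  then have cont: "continuous_on {u..v} f" if "0 \<le> u" "v \<le> \<phi> pi" for u v
    by (rule continuous_on_subset) (use that in auto)
  consider "t \<le> s" | "s \<le> t" by linarith
  then have "f t \<le> f s"
  proof cases
    case 1
    show ?thesis
    proof (rule DERIV_nonneg_imp_increasing_open[where f = f, OF 1])
      fix u assume u: "t < u" "u < s"
      then obtain c where c: "c > 0" "(f has_real_derivative - c * sin (2 * (u - s))) (at u)"
        using der[of u] s t by auto
      have "sin (2 * (s - u)) \<ge> 0" using u t by (intro sin_ge_zero) auto
      then have "sin (2 * (u - s)) \<le> 0"
        using sin_minus[of "2 * (s - u)"] by (simp add: algebra_simps)
      then show "\<exists>y. (f has_real_derivative y) (at u) \<and> 0 \<le> y"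
        using c by (intro exI conjI) (auto intro!: mult_nonneg_nonpos)
    qed (use cont s t in auto)
  next
    case 2
    show ?thesis
    proof (rule DERIV_nonpos_imp_decreasing_open[where f = f, OF 2])
      fix u assume u: "s < u" "u < t"
      then obtain c where c: "c > 0" "(f has_real_derivative - c * sin (2 * (u - s))) (at u)"
        using der[of u] s t by auto
      have "sin (2 * (u - s)) \<ge> 0" using u t by (intro sin_ge_zero) auto
      then show "\<exists>y. (f has_real_derivative y) (at u) \<and> y \<le> 0"
        using c by (intro exI conjI) auto
    qed (use cont s t in auto)
  qed
  then show ?thesis by (simp add: f_def)
qed

lemma rel_max_on_abs_eq:
  "rel_max_on {-1..1} (\<lambda>x. \<bar>poly p x\<bar>) = node ` {t \<in> {0..\<phi> pi}. sin t = 0}"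
proof (intro equalityI subsetI)
  fix x assume "x \<in> node ` {t \<in> {0..\<phi> pi}. sin t = 0}"
  then obtain s where s: "s \<in> {0..\<phi> pi}" "sin s = 0" "x = node s" by auto
  have x: "x \<in> {-1..1}" using s node_in by simp
  define \<psi> where "\<psi> y = \<phi> (arccos y)" for y
  have "\<psi> x = s"
    unfolding \<psi>_def using s angle_in[of s] phase_angle[of s] by (simp add: node_def arccos_cos)
  moreover have "continuous_on {-1..1} \<psi>"
    unfolding \<psi>_def
    by (rule continuous_on_compose2[OF phase_cont continuous_on_arccos'])
      (auto simp: arccos_lbound arccos_ubound)
  ultimately have "(\<psi> \<longlongrightarrow> s) (at x within {-1..1})"
    using x unfolding continuous_on_def by auto
  then have "\<forall>\<^sub>F y in at x within {-1..1}. dist (\<psi> y) s < pi / 2"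
    by (rule tendstoD) simp
  moreover have "\<forall>\<^sub>F y in at x within {-1..1}. y \<in> {-1..1}"
    by (simp add: eventually_at_filter)
  ultimately have "\<forall>\<^sub>F y in at x within {-1..1}. \<bar>poly p y\<bar> \<le> \<bar>poly p x\<bar>"
  proof eventually_elim
    case (elim y)
    then have "poly p (node (\<psi> y)) ^ 2 \<le> poly p (node s) ^ 2"
      using node_phase_arccos[of y] s
      by (intro square_le_at_extremum) (auto simp: \<psi>_def dist_real_def)
    then show ?case
      using node_phase_arccos[of y] elim s by (simp add: \<psi>_def abs_le_square_iff)
  qed
  with x show "x \<in> rel_max_on {-1..1} (\<lambda>x. \<bar>poly p x\<bar>)" by (simp add: rel_max_on_def)
next
  fix x assume xm: "x \<in> rel_max_on {-1..1} (\<lambda>x. \<bar>poly p x\<bar>)"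
  then have x: "x \<in> {-1..1}" by (simp add: rel_max_on_def)
  define t where "t = \<phi> (arccos x)"
  have t: "t \<in> {0..\<phi> pi}" "node t = x" using node_phase_arccos[OF x] by (auto simp: t_def)
  have "sin t = 0"
  proof (cases "t \<in> {0<..<\<phi> pi}")
    case False
    obtain m :: nat where "\<phi> pi = real m * pi" by (rule phase_pi_multiple)
    with False t show ?thesis by (cases "t = 0") auto
  next
    case True
    then have "x \<in> {-1<..<1}" using node_image t by blast
    then have "\<forall>\<^sub>F y in at x. \<bar>poly p y\<bar> \<le> \<bar>poly p x\<bar>"
      using xm by (simp add: rel_max_on_def at_within_Icc_at)
    then obtain d where d: "d > 0" "\<And>y. \<bar>x - y\<bar> < d \<Longrightarrow> \<bar>poly p y\<bar> \<le> \<bar>poly p x\<bar>"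
      unfolding eventually_at by (metis dist_commute dist_real_def order_refl UNIV_I)
    have "poly p' x = 0"
    proof (cases "poly p x \<ge> 0")
      case True
      then show ?thesis
        using DERIV_local_max[OF poly_DERIV[of p x] d(1)] d(2) by force
    next
      case False
      then have "- poly p' x = 0"
        using DERIV_local_max[OF DERIV_minus[OF poly_DERIV[of p x]] d(1)] d(2) by force
      then show ?thesis by simp
    qed
    then show ?thesis using pderiv_node_eq_0_iff[OF True] t by simp
  qed
  with t show "x \<in> node ` {t \<in> {0..\<phi> pi}. sin t = 0}" by auto
qed

end

lemma rev_sorted_list_of_set_image_nth:
  fixes f :: "nat \<Rightarrow> 'a :: linorder"
  assumes dec: "\<And>i j. i < j \<Longrightarrow> j \<le> n \<Longrightarrow> f j < f i" and "k \<le> n"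
  shows "rev (sorted_list_of_set (f ` {0..n})) ! k = f k"
proof -
  let ?xs = "map f [0..<Suc n]"
  have set: "set (rev ?xs) = f ` {0..n}" 
    by (simp add: atLeastLessThanSuc_atLeastAtMost del: upt_Suc)
  have "sorted_wrt (<) (rev ?xs)"
    unfolding sorted_wrt_rev sorted_wrt_map by (auto simp: sorted_wrt_iff_nth_less intro!: dec simp del: upt_Suc)
  then have "sorted_list_of_set (set (rev ?xs)) = rev ?xs"
    by (intro sorted_list_of_set.idem_if_sorted_distinct) (auto simp: strict_sorted_iff)
  then show ?thesis unfolding set using assms(2) by (simp del: upt_Suc)
qed

section \<open>Jacobi polynomials\<close>

context
  fixes \<alpha> \<beta> :: real
  assumes \<alpha>: "\<alpha> > -1/2" and \<beta>: "\<beta> > -1/2"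
begin

lemma jacobi_poly_at_1_pos: "poly (jacobi_poly \<alpha> \<beta> n) 1 > 0"
  unfolding poly_jacobi_poly_1 using \<alpha> by (intro divide_pos_pos pochhammer_pos) auto

definition jacobi_normed :: "nat \<Rightarrow> real poly" where
  "jacobi_normed n = smult (1 / poly (jacobi_poly \<alpha> \<beta> n) 1) (jacobi_poly \<alpha> \<beta> n)"

definition jacobi_freq :: "nat \<Rightarrow> real" where
  "jacobi_freq n = sqrt (real n * (real n + (\<alpha> + 1/2) + (\<beta> + 1/2)))"

lemma jacobi_normed_1: "poly (jacobi_normed n) 1 = 1"
  using jacobi_poly_at_1_pos[of n] by (simp add: jacobi_normed_def)

lemma poly_jacobi_eq: "poly (jacobi_poly \<alpha> \<beta> n) x = poly (jacobi_poly \<alpha> \<beta> n) 1 * poly (jacobi_normed n) x"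
  using jacobi_poly_at_1_pos[of n] by (simp add: jacobi_normed_def)

lemma jacobi_normed_ode:
  "jacobi_ode (\<alpha> + 1/2) (\<beta> + 1/2) (real n * (real n + (\<alpha> + 1/2) + (\<beta> + 1/2))) (jacobi_normed n)"
  unfolding jacobi_ode_def
proof
  fix x
  define c P where "c = 1 / poly (jacobi_poly \<alpha> \<beta> n) 1" and "P = jacobi_poly \<alpha> \<beta> n"
  have N: "jacobi_normed n = smult c P" by (simp add: jacobi_normed_def c_def P_def)
  have "(1 - x^2) * poly (pderiv (pderiv P)) x
      = (\<alpha> - \<beta> + (\<alpha> + \<beta> + 2) * x) * poly (pderiv P) x
        - (real n * (real n + \<alpha> + \<beta> + 1)) * poly P x"
    using arg_cong[OF jacobi_poly_ode[of \<alpha> \<beta> n], of "\<lambda>q. poly q x"]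
    by (simp add: P_def algebra_simps power2_eq_square)
  then have "c * ((1 - x^2) * poly (pderiv (pderiv P)) x)
      = c * ((\<alpha> - \<beta> + (\<alpha> + \<beta> + 2) * x) * poly (pderiv P) x
        - (real n * (real n + \<alpha> + \<beta> + 1)) * poly P x)" by simp
  then show "(1 - x^2) * poly (pderiv (pderiv (jacobi_normed n))) x
    = (2 * drift (\<alpha> + 1/2) (\<beta> + 1/2) x + x) * poly (pderiv (jacobi_normed n)) x
      - real n * (real n + (\<alpha> + 1/2) + (\<beta> + 1/2)) * poly (jacobi_normed n) x"
    unfolding two_drift N Polynomial.pderiv_smult poly_smult
    by (simp add: algebra_simps)
qed

lemma jacobi_phase_exists:
  assumes "n \<ge> 1"
  shows "\<exists>\<phi>. jacobi_phase (\<alpha> + 1/2) (\<beta> + 1/2) (jacobi_freq n) (jacobi_normed n) \<phi> \<and> \<phi> pi = real n * pi"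
proof -
  have pos: "real n * (real n + (\<alpha> + 1/2) + (\<beta> + 1/2)) > 0"
    using \<alpha> \<beta> assms by (intro mult_pos_pos) auto
  have ne: "jacobi_normed n \<noteq> 0" using jacobi_normed_1[of n] by auto
  interpret jacobi_solution "\<alpha> + 1/2" "\<beta> + 1/2" "jacobi_freq n" "jacobi_normed n"
    using \<alpha> \<beta> pos ne jacobi_normed_ode[of n] by unfold_locales (auto simp: jacobi_freq_def)
  obtain \<phi> where \<phi>: "jacobi_phase (\<alpha> + 1/2) (\<beta> + 1/2) (jacobi_freq n) (jacobi_normed n) \<phi>"
    using phase_exists by blast
  then interpret jacobi_phase "\<alpha> + 1/2" "\<beta> + 1/2" "jacobi_freq n" "jacobi_normed n" \<phi> .
  have "\<phi> pi = real n * pi"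
    using card_zeros card_zeros_eq_index[OF jacobi_normed_ode a b ne] by simp
  with \<phi> show ?thesis by blast
qed

lemma jacobi_maxima_nodes:
  assumes "jacobi_phase (\<alpha> + 1/2) (\<beta> + 1/2) (jacobi_freq n) (jacobi_normed n) \<phi>"
    and n: "\<phi> pi = real n * pi"
  shows "jacobi_maxima \<alpha> \<beta> n = (\<lambda>k. jacobi_phase.node \<phi> (real k * pi)) ` {0..n}"
    and "k \<le> n \<Longrightarrow> jacobi_max_pt \<alpha> \<beta> k n = jacobi_phase.node \<phi> (real k * pi)"
proof -
  interpret jacobi_phase "\<alpha> + 1/2" "\<beta> + 1/2" "jacobi_freq n" "jacobi_normed n" \<phi> by fact
  have "jacobi_maxima \<alpha> \<beta> n
      = rel_max_on {-1..1} (\<lambda>x. poly (jacobi_poly \<alpha> \<beta> n) 1 * \<bar>poly (jacobi_normed n) x\<bar>)"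
    unfolding jacobi_maxima_def
    by (subst poly_jacobi_eq) (use jacobi_poly_at_1_pos[of n] in \<open>simp add: abs_mult\<close>)
  also have "\<dots> = node ` {t \<in> {0..\<phi> pi}. sin t = 0}"
    by (simp only: rel_max_on_mult[OF jacobi_poly_at_1_pos] rel_max_on_abs_eq)
  also have "{t \<in> {0..\<phi> pi}. sin t = 0} = (\<lambda>k. real k * pi) ` {0..n}" (is "?L = ?R")
  proof (intro equalityI subsetI)
    fix t assume t: "t \<in> ?L"
    then obtain i :: int where i: "t = real_of_int i * pi" by (auto simp: sin_zero_iff_int2)
    then have "0 * pi \<le> real_of_int i * pi" "real_of_int i * pi \<le> real n * pi" using t n by auto
    then have "0 \<le> real_of_int i" "real_of_int i \<le> real n"
      by (simp_all only: mult_le_cancel_right_pos[OF pi_gt_zero])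
    then show "t \<in> ?R" using i by (intro image_eqI[of _ _ "nat i"]) auto
  qed (use n in auto)
  finally show max: "jacobi_maxima \<alpha> \<beta> n = (\<lambda>k. node (real k * pi)) ` {0..n}"
    by (simp add: image_image)
  show "jacobi_max_pt \<alpha> \<beta> k n = node (real k * pi)" if "k \<le> n"
    unfolding jacobi_max_pt_def max
    by (rule rev_sorted_list_of_set_image_nth[OF _ that]) (auto intro!: node_antimono simp: n)
qed

end

theorem theorem1p1:
  fixes \<alpha> \<beta> :: real
  assumes "\<alpha> > -1/2" and "\<beta> > -1/2"
  shows
    "(\<forall>n\<ge>1. jacobi_maxima \<alpha> \<beta> n = (\<lambda>k. jacobi_max_pt \<alpha> \<beta> k n) ` {0..n}
        \<and> jacobi_max_pt \<alpha> \<beta> 0 n = 1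
        \<and> jacobi_max_pt \<alpha> \<beta> n n = -1
        \<and> (\<forall>k<n. jacobi_max_pt \<alpha> \<beta> k n > jacobi_max_pt \<alpha> \<beta> (Suc k) n))
     \<and>
     (\<forall>n\<ge>1. \<forall>k\<in>{1..n}.
        \<bar>poly (jacobi_poly \<alpha> \<beta> (n + 1)) (jacobi_max_pt \<alpha> \<beta> k (n + 1))\<bar>
            / poly (jacobi_poly \<alpha> \<beta> (n + 1)) 1
        < \<bar>poly (jacobi_poly \<alpha> \<beta> n) (jacobi_max_pt \<alpha> \<beta> k n)\<bar>
            / poly (jacobi_poly \<alpha> \<beta> n) 1)"
proof (intro conjI allI impI ballI)
  fix n :: nat assume n: "1 \<le> n"
  obtain \<phi> where \<phi>: "jacobi_phase (\<alpha> + 1/2) (\<beta> + 1/2) (jacobi_freq \<alpha> \<beta> n) (jacobi_normed \<alpha> \<beta> n) \<phi>"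
    and \<phi>n: "\<phi> pi = real n * pi"
    using jacobi_phase_exists[OF assms n] by blast
  interpret S1: jacobi_phase "\<alpha> + 1/2" "\<beta> + 1/2" "jacobi_freq \<alpha> \<beta> n" "jacobi_normed \<alpha> \<beta> n" \<phi> by fact
  note max = jacobi_maxima_nodes[OF assms \<phi> \<phi>n]
  show "jacobi_maxima \<alpha> \<beta> n = (\<lambda>k. jacobi_max_pt \<alpha> \<beta> k n) ` {0..n}"
    unfolding max(1) by (rule image_cong) (simp_all add: max(2))
  show "jacobi_max_pt \<alpha> \<beta> 0 n = 1" by (simp add: max(2) S1.node_0)
  show "jacobi_max_pt \<alpha> \<beta> n n = -1" using S1.node_end by (simp add: max(2) \<phi>n)
  show "jacobi_max_pt \<alpha> \<beta> k n > jacobi_max_pt \<alpha> \<beta> (Suc k) n" if "k < n" for k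
    unfolding max(2)[OF Suc_leI[OF that]] max(2)[OF less_imp_le[OF that]]
    using that by (intro S1.node_antimono) (auto simp: \<phi>n intro!: mult_right_mono)
  fix k assume k: "k \<in> {1..n}"
  obtain \<psi> where \<psi>: "jacobi_phase (\<alpha> + 1/2) (\<beta> + 1/2) (jacobi_freq \<alpha> \<beta> (n + 1)) (jacobi_normed \<alpha> \<beta> (n + 1)) \<psi>"
    and \<psi>n: "\<psi> pi = real (n + 1) * pi"
    using jacobi_phase_exists[OF assms, of "n + 1"] by auto
  interpret S2: jacobi_phase "\<alpha> + 1/2" "\<beta> + 1/2" "jacobi_freq \<alpha> \<beta> (n + 1)" "jacobi_normed \<alpha> \<beta> (n + 1)" \<psi>
    by fact
  note max' = jacobi_maxima_nodes[OF assms \<psi> \<psi>n]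
  interpret jacobi_pair "\<alpha> + 1/2" "\<beta> + 1/2" "jacobi_freq \<alpha> \<beta> n" "jacobi_normed \<alpha> \<beta> n" \<phi>
    "jacobi_freq \<alpha> \<beta> (n + 1)" "jacobi_normed \<alpha> \<beta> (n + 1)" \<psi>
  proof
    show "jacobi_freq \<alpha> \<beta> n < jacobi_freq \<alpha> \<beta> (n + 1)"
      unfolding jacobi_freq_def[OF assms] using assms n
      by (intro real_sqrt_less_mono mult_strict_mono) auto
    show "\<phi> pi \<le> \<psi> pi" by (simp add: \<phi>n \<psi>n)
  qed
  have ratio: "\<bar>poly (jacobi_poly \<alpha> \<beta> m) x\<bar> / poly (jacobi_poly \<alpha> \<beta> m) 1 = \<bar>poly (jacobi_normed \<alpha> \<beta> m) x\<bar>" for m x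
    using jacobi_poly_at_1_pos[OF assms, of m] by (simp add: poly_jacobi_eq[OF assms, of m x] abs_mult)
  show "\<bar>poly (jacobi_poly \<alpha> \<beta> (n + 1)) (jacobi_max_pt \<alpha> \<beta> k (n + 1))\<bar>
            / poly (jacobi_poly \<alpha> \<beta> (n + 1)) 1
        < \<bar>poly (jacobi_poly \<alpha> \<beta> n) (jacobi_max_pt \<alpha> \<beta> k n)\<bar>
            / poly (jacobi_poly \<alpha> \<beta> n) 1"
    unfolding ratio using extrema_less[of k] k max(2)[of k] max'(2)[of k]
    by (simp add: jacobi_normed_1[OF assms] \<phi>n)
qed

end
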